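(* Let $\varphi\in\mathrm{Lip}(\mathbb{R}^n)$ and $\varepsilon>0$. For a Lipschitz vector field $g$ (as specified below) let $u^\varepsilon(t;c)$ be the solution of the characteristic ODE $\dot u^\varepsilon=g$, $u^\varepsilon(0)=c$, and let $V^\varepsilon(x,t)=\varphi(x_0)$ where $x_0$ is the unique point with $u^\varepsilon(t;x_0)=x$ (the weak solution of $V^\varepsilon_t+g\cdot DV^\varepsilon=0$, $V^\varepsilon(\cdot,0)=\varphi$). (1) Let $n>1$ and $f\in C(\mathbb{R}^{n+1},\mathbb{R}^n)$ be $\kappa$-Lipschitz and $\mathbb{Z}^{n+1}$-periodic in $(r,\tau)$, with $g=f(u^\varepsilon/\varepsilon,t/\varepsilon)$. Assume there is $C_0>0$ such that the solutions $v(\tau;c)$ of $\dot v=f(v,\tau)$, $v(0)=c$, satisfy $v_i(\tau;c^2)-v_i(\tau;c^1)\le C_0$ for all $i$, $\tau>0$, and $c^1,c^2\in\mathbb{R}^n$ with $c^1-c^2\in[0,1]^n$. Then there is $\bar\xi\in\mathbb{R}^n$ such that for all $t>0$, $x\in\mathbb{R}^n$, \[|V^\varepsilon(x,t)-\varphi(x-\bar\xi t)|\leq \|D\varphi\|_\infty\Big(1+C_0+2\max_{1\le i\le n}\|f_i\|_\infty\Big)\varepsilon.\] (2) Let $n=1$. (2-1) If $f\in C(\mathbb{R}^2)$ is $\kappa$-Lipschitz and $\mathbb{Z}^2$-periodic, $g=f(u^\varepsilon/\varepsilon,t/\varepsilon)$, then there is $\bar\xi\in\mathbb{R}$ with $|V^\varepsilon(x,t)-\varphi(x-\bar\xi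 t)|\le \|D\varphi\|_\infty(1+2\|f\|_\infty)\varepsilon$ for all $t>0$, $x\in\mathbb{R}$; if moreover $f(r,\tau)$ is independent of $\tau$, then $|V^\varepsilon(x,t)-\varphi(x-\bar\xi t)|\le \|D\varphi\|_\infty\varepsilon$. (2-2) If $g=f(u^\varepsilon/\varepsilon)$ where $f(r)=F(\xi_0 r)$, with $\xi_0\in\mathbb{R}^d$ having Diophantine index $\sigma_{\xi_0}>0$ (i.e. $|\xi_0\cdot k|\ge C_{\xi_0}|k|^{-\sigma_{\xi_0}}$ for all $k\in\mathbb{Z}^d\setminus\{0\}$, some $C_{\xi_0}>0$), $F\in C^m(\mathbb{T}^d)$, $m>d+\sigma_{\xi_0}$, $F>0$, then there exist $\bar\xi\in\mathbb{R}$ and $C>0$ depending on $d$ and $F$ such that $|V^\varepsilon(x,t)-\varphi(x-\bar\xi t)|\le \|D\varphi\|_\infty C\varepsilon$ for all $t>0$, $x\in\mathbb{R}$.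
   Context: For $c\in\mathbb{R}^n$, $\|c\|=\max_i|c_i|$. For $\varphi\in\mathrm{Lip}(\mathbb{R}^n)$ (globally Lipschitz), $\|D\varphi\|_\infty$ is the smallest $C>0$ with $|\varphi(x)-\varphi(y)|\le C\|x-y\|$ for all $x,y$. $\mathbb{T}^d=\mathbb{R}^d/\mathbb{Z}^d$. *)

theory Defs
  imports "HOL-Analysis.Analysis"
begin

definition maxnorm :: "real^'n \<Rightarrow> real" where
  "maxnorm x = Max (range (\<lambda>i. \<bar>x $ i\<bar>))"

definition lipschitz_wrt :: "('a \<Rightarrow> real) \<Rightarrow> ('a::real_vector \<Rightarrow> real) \<Rightarrow> bool" where
  "lipschitz_wrt N \<phi> \<longleftrightarrow> (\<exists>C. \<forall>x y. \<bar>\<phi> x - \<phi> y\<bar> \<le> C * N (x - y))"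

definition lip_const :: "('a \<Rightarrow> real) \<Rightarrow> ('a::real_vector \<Rightarrow> real) \<Rightarrow> real" where
  "lip_const N \<phi> = Inf {C. C > 0 \<and> (\<forall>x y. \<bar>\<phi> x - \<phi> y\<bar> \<le> C * N (x - y))}"

definition is_ode_sol :: "('a::real_normed_vector \<Rightarrow> real \<Rightarrow> 'a) \<Rightarrow> 'a \<Rightarrow> (real \<Rightarrow> 'a) \<Rightarrow> bool" where
  "is_ode_sol G c u \<longleftrightarrow> u 0 = c \<and>
     (\<forall>t\<ge>0. (u has_vector_derivative G (u t) t) (at t within {0..}))"

definition ode_flow :: "('a::real_normed_vector \<Rightarrow> real \<Rightarrow> 'a) \<Rightarrow> real \<Rightarrow> 'a \<Rightarrow> 'a" where
  "ode_flow G t c = (THE y. \<exists>u. is_ode_sol G c u \<and> u t = y)"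

text \<open>Weak solution of V_t + G . DV = 0, V(.,0) = phi: V(x,t) = phi(x0), u(t;x0) = x.\<close>
definition transport_sol :: "('a \<Rightarrow> real) \<Rightarrow> ('a::real_normed_vector \<Rightarrow> real \<Rightarrow> 'a) \<Rightarrow> 'a \<Rightarrow> real \<Rightarrow> real" where
  "transport_sol \<phi> G x t = \<phi> (THE x0. ode_flow G t x0 = x)"

fun Ck :: "nat \<Rightarrow> (real^'d \<Rightarrow> real) \<Rightarrow> bool" where
  "Ck 0 F = continuous_on UNIV F"
| "Ck (Suc m) F = (continuous_on UNIV F \<and> F differentiable_on UNIV \<and>
     (\<forall>i. Ck m (\<lambda>x. frechet_derivative F (at x) (axis i 1))))"

definition int_vec :: "(real^'d) set" where
  "int_vec = {k. \<forall>i. k $ i \<in> \<int>}"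

end

theory Submission
  imports Defs
begin

text \<open>After rescaling, every estimate is a bound on \<open>v(\<tau>; c) - c - \<tau> \<xi>\<close> for the unscaled flow, uniform
  in \<open>\<tau>\<close> and \<open>c\<close>. For periodic fields the displacement \<open>v(m; c) - c\<close> at integer times is an
  additive cocycle over the time-one map whose oscillation in \<open>c\<close> is bounded uniformly in \<open>m\<close>
  (by \<open>1 + C\<^sub>0\<close>, or by 1 in dimension one, where the flow is monotone); such a cocycle stays
  within its oscillation bound of \<open>m \<xi>\<close>. In the quasi-periodic case \<open>1/F(v \<xi>\<^sub>0) dv = d\<tau>\<close>, so it suffices
  that a primitive of \<open>r \<mapsto> 1/F(r \<xi>\<^sub>0)\<close> is linear up to a bounded error. Instead of a Fourier series
  on the torus, trigonometric interpolation on finite grids is used: repeated differences give the decay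
  \<open>|k|\<^bsup>-m\<^esup>\<close> of the discrete Fourier coefficients uniformly in the grid size, the small divisors
  cost \<open>|k|\<^bsup>\<sigma>\<^esup>\<close>, and \<open>m - \<sigma> > d\<close> makes the sum over the lattice finite.\<close>

section \<open>Flows of bounded Lipschitz fields\<close>

text \<open>\<open>ode_flow\<close> and \<open>transport_sol\<close> are definite descriptions, so
  they carry no information until the flow is known to exist for all times \<ge> 0, to be unique and
  to be a bijection of the space. The drift bounds are then proved for the flow alone, which is why
  the drift found depends neither on \<phi> nor on \<epsilon>. Sampling at integer times leaves a
  remainder of less than one period; this is the origin of the term with twice the supremum of the
  field. An autonomous scalar field may be sampled with any period, in particular with the time of
  interest itself, so there only the oscillation 1 survives. The trigonometric interpolants must
  converge uniformly, because their error is multiplied by the elapsed time; the grid is refined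
  while that time is held fixed. The mean over the torus never appears as an integral: a
  subsequential limit of the zeroth discrete coefficients takes its place.\<close>

lemma has_vector_derivative_integral_from_0:
  fixes g :: "real \<Rightarrow> 'a::banach"
  assumes g: "continuous_on UNIV g" and x: "0 \<le> x"
  shows "((\<lambda>u. integral {0..u} g) has_vector_derivative g x) (at x within {0..})"
proof -
  have "((\<lambda>u. integral {0..u} g) has_vector_derivative g x) (at x within {0..x+1})"
    by (rule integral_has_vector_derivative) (use x continuous_on_subset[OF g] in auto)
  moreover have "at x within {0..x+1} = at x within {0..}"
    by (rule at_within_nhd[where S="{x-1<..<x+1}"]) auto
  ultimately show ?thesis by simp
qed

text \<open>The global bound keeps the weighted Picard iterates among the bounded functions, and
  \<open>L > 0\<close> makes the weight absorb linear growth; the concrete fields below add 1 to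
  their Lipschitz constants to secure it. The assumptions range over all real times, so the
  time-reversed field is an instance as well.\<close>

locale bounded_lipschitz_field =
  fixes G :: "'a::{real_inner,banach} \<Rightarrow> real \<Rightarrow> 'a" and L B :: real
  assumes cont: "continuous_on UNIV (\<lambda>(x,t). G x t)"
    and lip: "norm (G x t - G y t) \<le> L * norm (x - y)"
    and bound: "norm (G x t) \<le> B"
    and L_pos: "L > 0"
begin

lemma continuous_on_field:
  assumes "continuous_on S u" "continuous_on S \<theta>"
  shows "continuous_on S (\<lambda>t. G (u t) (\<theta> t))"
  using continuous_on_compose2[OF cont continuous_on_Pair[OF assms]] by simp

lemma solution_deriv:
  assumes "is_ode_sol G c u" "t \<ge> 0"
  shows "(u has_vector_derivative G (u t) t) (at t within {0..})"
  using assms unfolding is_ode_sol_def by auto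

text \<open>Picard's map is a contraction of ratio 1/2 on all of \<open>{0..}\<close> for the sup norm with weight
  \<open>exp (- 2 * L * t)\<close>; \<open>max 0 t\<close> extends it to a map on bounded continuous functions
  on the whole line.\<close>

lemma solution_exists: "\<exists>u. is_ode_sol G c u"
proof -
  \<comment> \<open>\<open>w\<close> is the weighted unknown: the curve it stands for is
    \<open>exp (2 * L * s) *\<^sub>R w s\<close>, and \<open>P\<close> multiplies Picard's integral
    by the inverse weight.\<close>
  define g where "g w s = G (exp (2 * L * s) *\<^sub>R apply_bcontfun w s) s"
    for w :: "real \<Rightarrow>\<^sub>C 'a" and s
  define P where "P w t = exp (- 2 * L * max 0 t) *\<^sub>R (c + integral {0..max 0 t} (g w))" for w t
  have g_cont: "continuous_on S (g w)" for w S
    unfolding g_def by (intro continuous_on_field continuous_intros) auto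
  have I_deriv: "((\<lambda>u. integral {0..u} (g w)) has_vector_derivative g w x) (at x within {0..})"
    if "0 \<le> x" for w x
    by (rule has_vector_derivative_integral_from_0[OF g_cont that])
  have I_cont: "continuous_on {0..} (\<lambda>u. integral {0..u} (g w))" for w
    unfolding continuous_on_eq_continuous_within
    using I_deriv has_vector_derivative_continuous by (metis atLeast_iff)
  have P_cont: "continuous_on UNIV (P w)" for w
  proof -
    have m: "continuous_on UNIV (\<lambda>t::real. max 0 t)" by (intro continuous_intros)
    have "continuous_on UNIV (\<lambda>t. integral {0..max 0 t} (g w))"
      by (rule continuous_on_compose2[OF I_cont m]) auto
    then show ?thesis unfolding P_def
      by (intro continuous_on_scaleR continuous_on_add continuous_on_exp continuous_on_mult_left continuous_on_const m)
  qed
  \<comment> \<open>Picard's integral grows at most like \<open>B * t\<close>; this estimate keeps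
    it bounded after weighting.\<close>
  have weight: "t * exp (- 2 * L * t) \<le> 1 / (2 * L)" if "t \<ge> 0" for t
  proof -
    have "2 * L * t \<le> exp (2 * L * t)" using exp_ge_add_one_self[of "2 * L * t"] by linarith
    then show ?thesis using L_pos by (simp add: exp_minus field_simps)
  qed
  have P_bound: "norm (P w t) \<le> norm c + B / (2 * L)" for w t
  proof -
    let ?t = "max 0 t"
    have B0: "B \<ge> 0" using bound[of 0 0] norm_ge_zero[of "G 0 0"] by linarith
    have "norm (integral {0..?t} (g w)) \<le> B * (?t - 0)"
      by (rule integral_bound[OF _ g_cont]) (auto simp: g_def bound)
    then have "norm (c + integral {0..?t} (g w)) \<le> norm c + B * ?t"
      by (intro order.trans[OF norm_triangle_ineq]) auto
    then have "norm (P w t) \<le> exp (- 2 * L * ?t) * (norm c + B * ?t)"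
      unfolding P_def by simp
    also have "\<dots> = exp (- 2 * L * ?t) * norm c + B * (?t * exp (- 2 * L * ?t))"
      by (simp add: algebra_simps)
    also have "\<dots> \<le> 1 * norm c + B * (1 / (2 * L))"
      by (intro add_mono mult_right_mono mult_left_mono weight)
        (use L_pos B0 in \<open>auto simp: zero_le_mult_iff\<close>)
    finally show ?thesis by simp
  qed
  define T where "T w = Bcontfun (P w)" for w
  have T: "apply_bcontfun (T w) = P w" for w
    unfolding T_def by (rule Bcontfun_inverse) (rule bcontfun_normI[OF P_cont P_bound])
  have contraction: "dist (T w) (T w') \<le> (1/2) * dist w w'" for w w'
  proof (rule dist_bound)
    fix t :: real
    let ?t = "max 0 t" and ?d = "dist w w'"
    \<comment> \<open>Integrating \<open>L * exp (2 * L * s)\<close> gives half an exponential: the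
      doubled rate in the weight is the source of the ratio 1/2.\<close>
    have E: "((\<lambda>s. L * exp (2 * L * s) * ?d) has_integral
        (exp (2 * L * ?t) * ?d / 2 - exp (2 * L * 0) * ?d / 2)) {0..?t}"
      by (rule fundamental_theorem_of_calculus)
        (auto intro!: derivative_eq_intros simp: has_real_derivative_iff_has_vector_derivative[symmetric])
    have "norm (integral {0..?t} (g w) - integral {0..?t} (g w'))
        = norm (integral {0..?t} (\<lambda>s. g w s - g w' s))"
      by (subst integral_diff) (auto intro!: integrable_continuous_real g_cont)
    also have "\<dots> \<le> integral {0..?t} (\<lambda>s. L * exp (2 * L * s) * ?d)"
    proof (rule integral_norm_bound_integral)
      show "(\<lambda>s. g w s - g w' s) integrable_on {0..?t}"
        by (intro integrable_continuous_real continuous_intros g_cont)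
      show "(\<lambda>s. L * exp (2 * L * s) * ?d) integrable_on {0..?t}"
        using E by (rule has_integral_integrable)
      fix s assume "s \<in> {0..?t}"
      have "norm (g w s - g w' s) \<le> L * norm (exp (2 * L * s) *\<^sub>R (w s - w' s))"
        unfolding g_def using lip by (simp add: scaleR_diff_right)
      also have "\<dots> = L * exp (2 * L * s) * dist (w s) (w' s)"
        by (simp add: dist_norm)
      also have "\<dots> \<le> L * exp (2 * L * s) * ?d"
        by (intro mult_left_mono dist_bounded) (use L_pos in auto)
      finally show "norm (g w s - g w' s) \<le> L * exp (2 * L * s) * ?d" .
    qed
    also have "\<dots> = exp (2 * L * ?t) * ?d / 2 - ?d / 2"
      using integral_unique[OF E] by simp
    also have "\<dots> \<le> exp (2 * L * ?t) * ?d / 2" by simp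
    finally have I: "norm (integral {0..?t} (g w) - integral {0..?t} (g w')) \<le> exp (2 * L * ?t) * ?d / 2" .
    have "dist (T w t) (T w' t)
        = exp (- 2 * L * ?t) * norm (integral {0..?t} (g w) - integral {0..?t} (g w'))"
      unfolding T P_def dist_norm by (simp flip: scaleR_diff_right)
    also have "\<dots> \<le> exp (- 2 * L * ?t) * (exp (2 * L * ?t) * ?d / 2)"
      by (intro mult_left_mono I) auto
    also have "\<dots> = (1/2) * ?d" by (simp add: exp_minus)
    finally show "dist (T w t) (T w' t) \<le> (1/2) * ?d" .
  qed
  have "\<exists>!w. T w = w"
    by (rule banach_fix_type[where c="1/2"]) (use contraction in auto)
  then obtain w where w: "T w = w" by blast
  define u where "u t = c + integral {0..t} (g w)" for t
  have gu: "g w t = G (u t) t" if "t \<ge> 0" for t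
  proof -
    have "w t = exp (- 2 * L * t) *\<^sub>R u t"
      using T[of w] that unfolding w P_def u_def by simp
    then show ?thesis unfolding g_def by (simp add: exp_minus)
  qed
  have "is_ode_sol G c u"
    unfolding is_ode_sol_def
  proof (intro conjI allI impI)
    show "u 0 = c" by (simp add: u_def)
    fix t :: real assume t: "t \<ge> 0"
    have "(u has_vector_derivative (0 + g w t)) (at t within {0..})"
      unfolding u_def by (intro derivative_intros I_deriv t)
    then show "(u has_vector_derivative G (u t) t) (at t within {0..})"
      by (simp add: gu[OF t])
  qed
  then show ?thesis by blast
qed

text \<open>The squared distance \<open>d\<close> has a derivative of size at most
  \<open>2 * L * d\<close>, so one exponential factor makes it decrease and the other makes it
  increase. The first bound gives uniqueness forward in time, the second injectivity of the flow.
  Solutions are only required on \<open>{0..T}\<close>, so that reversed trajectories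
  qualify.\<close>

lemma solutions_diff_exp_bounds:
  fixes u w :: "real \<Rightarrow> 'a"
  assumes u: "\<And>t. t \<in> {0..T} \<Longrightarrow> (u has_vector_derivative G (u t) t) (at t within {0..T})"
    and w: "\<And>t. t \<in> {0..T} \<Longrightarrow> (w has_vector_derivative G (w t) t) (at t within {0..T})"
    and ab: "0 \<le> a" "a \<le> b" "b \<le> T"
  shows "(norm (u b - w b))\<^sup>2 * exp (- 2 * L * b) \<le> (norm (u a - w a))\<^sup>2 * exp (- 2 * L * a)"
    and "(norm (u a - w a))\<^sup>2 * exp (2 * L * a) \<le> (norm (u b - w b))\<^sup>2 * exp (2 * L * b)"
proof -
  define d where "d t = (u t - w t) \<bullet> (u t - w t)" for t
  define e where "e t = (u t - w t) \<bullet> (G (u t) t - G (w t) t)" for t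
  have d: "(d has_real_derivative 2 * e t) (at t within {0..T})" if "t \<in> {0..T}" for t
  proof -
    have D: "((\<lambda>t. u t - w t) has_derivative (\<lambda>h. h *\<^sub>R (G (u t) t - G (w t) t))) (at t within {0..T})"
      using has_vector_derivative_diff[OF u[OF that] w[OF that]]
      by (simp add: has_vector_derivative_def)
    show ?thesis
      unfolding d_def e_def has_field_derivative_def
      by (rule has_derivative_eq_rhs[OF has_derivative_inner[OF D D]])
        (simp add: fun_eq_iff inner_commute algebra_simps)
  qed
  have e: "\<bar>e t\<bar> \<le> L * d t" for t
  proof -
    have "\<bar>e t\<bar> \<le> norm (u t - w t) * norm (G (u t) t - G (w t) t)"
      unfolding e_def by (rule Cauchy_Schwarz_ineq2)
    also have "\<dots> \<le> norm (u t - w t) * (L * norm (u t - w t))"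
      by (intro mult_left_mono lip) auto
    finally show ?thesis unfolding d_def by (simp add: dot_square_norm power2_eq_square mult.left_commute)
  qed
  have mono: "p a \<le> p b"
    if "\<And>t. t \<in> {0..T} \<Longrightarrow> (p has_real_derivative q t) (at t within {0..T})"
      and "\<And>t. q t \<ge> 0" for p q :: "real \<Rightarrow> real"
  proof (rule DERIV_nonneg_imp_increasing_open[OF ab(2)])
    fix t assume t: "a < t" "t < b"
    then have "at t within {0..T} = at t" using ab by (intro at_within_interior) auto
    then show "\<exists>y. (p has_real_derivative y) (at t) \<and> 0 \<le> y"
      using that t ab by (metis atLeastAtMost_iff less_eq_real_def order.trans)
  next
    have "continuous_on {0..T} p"
      using that(1) by (meson DERIV_continuous_on)
    then show "continuous_on {a..b} p" by (rule continuous_on_subset) (use ab in auto)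
  qed
  have "- (d a * exp (- 2 * L * a)) \<le> - (d b * exp (- 2 * L * b))"
  proof (rule mono)
    fix t assume "t \<in> {0..T}"
    then show "((\<lambda>t. - (d t * exp (- 2 * L * t))) has_real_derivative
        2 * (L * d t - e t) * exp (- 2 * L * t)) (at t within {0..T})"
      by (auto intro!: derivative_eq_intros d simp: algebra_simps)
  qed (use e in \<open>auto simp: abs_le_iff\<close>)
  then show "(norm (u b - w b))\<^sup>2 * exp (- 2 * L * b) \<le> (norm (u a - w a))\<^sup>2 * exp (- 2 * L * a)"
    by (simp add: d_def dot_square_norm)
  have "d a * exp (2 * L * a) \<le> d b * exp (2 * L * b)"
  proof (rule mono)
    fix t assume "t \<in> {0..T}"
    then show "((\<lambda>t. d t * exp (2 * L * t)) has_real_derivative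
        2 * (L * d t + e t) * exp (2 * L * t)) (at t within {0..T})"
      by (auto intro!: derivative_eq_intros d simp: algebra_simps)
  next
    show "2 * (L * d t + e t) * exp (2 * L * t) \<ge> 0" for t
      using e[of t] by (intro mult_nonneg_nonneg) auto
  qed
  then show "(norm (u a - w a))\<^sup>2 * exp (2 * L * a) \<le> (norm (u b - w b))\<^sup>2 * exp (2 * L * b)"
    by (simp add: d_def dot_square_norm)
qed

lemma solution_on_Icc:
  assumes "is_ode_sol G c u" "t \<in> {0..T}"
  shows "(u has_vector_derivative G (u t) t) (at t within {0..T})"
  by (rule has_vector_derivative_within_subset[OF solution_deriv[OF assms(1)]]) (use assms(2) in auto)

lemma solution_unique_forward:
  assumes "\<And>t. t \<in> {0..T} \<Longrightarrow> (u has_vector_derivative G (u t) t) (at t within {0..T})"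
    and "\<And>t. t \<in> {0..T} \<Longrightarrow> (w has_vector_derivative G (w t) t) (at t within {0..T})"
    and "u 0 = w 0" "0 \<le> T"
  shows "u T = w T"
  using solutions_diff_exp_bounds(1)[OF assms(1,2), of 0 T] assms(3,4)
  by (simp add: mult_le_0_iff)

lemma ode_flow_eqI:
  assumes "is_ode_sol G c u" "t \<ge> 0"
  shows "ode_flow G t c = u t"
  unfolding ode_flow_def
proof (rule the_equality)
  show "\<exists>w. is_ode_sol G c w \<and> w t = u t" using assms by blast
  fix y assume "\<exists>w. is_ode_sol G c w \<and> w t = y"
  then obtain w where w: "is_ode_sol G c w" "w t = y" by blast
  have "w t = u t"
    by (rule solution_unique_forward[OF solution_on_Icc[OF w(1)] solution_on_Icc[OF assms(1)]])
      (use w assms in \<open>auto simp: is_ode_sol_def\<close>)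
  then show "y = u t" using w by simp
qed

lemma ode_flow_solution: "is_ode_sol G c (\<lambda>t. ode_flow G t c)"
proof -
  obtain u where u: "is_ode_sol G c u" using solution_exists by blast
  have eq: "ode_flow G t c = u t" if "t \<ge> 0" for t using ode_flow_eqI[OF u that] .
  show ?thesis
    unfolding is_ode_sol_def
  proof (intro conjI allI impI)
    show "ode_flow G 0 c = c" using u eq by (simp add: is_ode_sol_def)
    fix t :: real assume t: "t \<ge> 0"
    show "((\<lambda>t. ode_flow G t c) has_vector_derivative G (ode_flow G t c) t) (at t within {0..})"
      unfolding eq[OF t]
      by (rule has_vector_derivative_transform[OF _ _ solution_deriv[OF u t]]) (use t eq in auto)
  qed
qed

lemma ode_flow_0 [simp]: "ode_flow G 0 c = c"
  using ode_flow_solution by (simp add: is_ode_sol_def)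

lemmas ode_flow_deriv = solution_deriv[OF ode_flow_solution]

lemma ode_flow_inj:
  assumes "ode_flow G t c = ode_flow G t c'" "t \<ge> 0"
  shows "c = c'"
  using solutions_diff_exp_bounds(2)[where T=t and a=0 and b=t,
      OF solution_on_Icc[OF ode_flow_solution[of c]] solution_on_Icc[OF ode_flow_solution[of c']]] assms
  by simp

lemma bounded_lipschitz_field_reverse: "bounded_lipschitz_field (\<lambda>x s. - G x (T - s)) L B"
proof
  show "continuous_on UNIV (\<lambda>(x, s). - G x (T - s))"
    unfolding case_prod_beta by (intro continuous_intros continuous_on_field)
qed (use lip bound L_pos in \<open>auto simp: norm_minus_commute\<close>)

text \<open>A preimage of \<open>x\<close> is found by running the field backwards: solve the
  reversed equation from \<open>x\<close> and read its solution from \<open>T\<close> down to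
  0.\<close>

lemma ode_flow_surj:
  assumes T: "T \<ge> 0"
  obtains c where "ode_flow G T c = x"
proof -
  interpret rev: bounded_lipschitz_field "\<lambda>x s. - G x (T - s)" L B
    by (rule bounded_lipschitz_field_reverse)
  obtain w where w: "is_ode_sol (\<lambda>x s. - G x (T - s)) x w" using rev.solution_exists by blast
  define u where "u s = w (T - s)" for s
  have u: "(u has_vector_derivative G (u s) s) (at s within {0..T})" if "s \<in> {0..T}" for s
  proof -
    have "(w has_vector_derivative - G (w (T - s)) s) (at (T - s) within {0..T})"
      using rev.solution_on_Icc[OF w, of "T - s" T] that by simp
    then have "(w has_vector_derivative - G (w (T - s)) s) (at (T - s) within (\<lambda>s. T - s) ` {0..T})"
      by (rule has_vector_derivative_within_subset) auto
    then have "((w \<circ> (\<lambda>s. T - s)) has_vector_derivative (-1) *\<^sub>R (- G (w (T - s)) s)) (at s within {0..T})"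
      by (intro vector_diff_chain_within) (auto intro!: derivative_eq_intros)
    then show ?thesis unfolding u_def o_def by simp
  qed
  have "ode_flow G T (u 0) = u T"
    by (rule solution_unique_forward[OF solution_on_Icc[OF ode_flow_solution] u]) (use T in auto)
  also have "\<dots> = x" using w by (simp add: u_def is_ode_sol_def)
  finally show ?thesis by (rule that)
qed

lemma transport_sol_ode_flow:
  assumes "t \<ge> 0"
  shows "transport_sol \<phi> G (ode_flow G t c) t = \<phi> c"
  unfolding transport_sol_def
  by (rule arg_cong[where f=\<phi>], rule the_equality) (use ode_flow_inj assms in auto)

lemma ode_flow_time_shift:
  assumes per: "\<And>x t. G x (t + s) = G x t" and "s \<ge> 0" "t \<ge> 0"
  shows "ode_flow G (t + s) c = ode_flow G t (ode_flow G s c)"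
proof -
  have "is_ode_sol G (ode_flow G s c) (\<lambda>t. ode_flow G (t + s) c)"
    unfolding is_ode_sol_def
  proof (intro conjI allI impI)
    fix t :: real assume t: "t \<ge> 0"
    have "((\<lambda>t. ode_flow G t c) has_vector_derivative G (ode_flow G (t + s) c) (t + s))
        (at (t + s) within (\<lambda>t. t + s) ` {0..})"
      by (rule has_vector_derivative_within_subset[OF ode_flow_deriv]) (use t assms in auto)
    then have "(((\<lambda>t. ode_flow G t c) \<circ> (\<lambda>t. t + s)) has_vector_derivative
        1 *\<^sub>R G (ode_flow G (t + s) c) (t + s)) (at t within {0..})"
      by (intro vector_diff_chain_within) (auto intro!: derivative_eq_intros)
    then show "((\<lambda>t. ode_flow G (t + s) c) has_vector_derivative G (ode_flow G (t + s) c) t)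
        (at t within {0..})"
      by (simp add: per o_def)
  qed simp
  then show ?thesis using ode_flow_eqI assms by metis
qed

lemma ode_flow_space_shift:
  assumes per: "\<And>x t. G (x + k) t = G x t" and "t \<ge> 0"
  shows "ode_flow G t (c + k) = ode_flow G t c + k"
proof -
  have "is_ode_sol G (c + k) (\<lambda>t. ode_flow G t c + k)"
    unfolding is_ode_sol_def
    by (auto simp: per intro!: derivative_eq_intros ode_flow_deriv)
  then show ?thesis using ode_flow_eqI assms by metis
qed

lemma ode_flow_displacement:
  assumes "\<And>x t. \<bar>G x t \<bullet> b\<bar> \<le> M" and "0 \<le> s" "s \<le> t"
  shows "\<bar>(ode_flow G t c - ode_flow G s c) \<bullet> b\<bar> \<le> M * (t - s)"
proof -
  have "norm (ode_flow G t c \<bullet> b - ode_flow G s c \<bullet> b) \<le> M * norm (t - s)"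
  proof (rule field_differentiable_bound[where S="{0..}" and f'="\<lambda>t. G (ode_flow G t c) t \<bullet> b"])
    fix z :: real assume "z \<in> {0..}"
    then show "((\<lambda>t. ode_flow G t c \<bullet> b) has_field_derivative G (ode_flow G z c) z \<bullet> b)
        (at z within {0..})"
      using bounded_linear.has_vector_derivative[OF bounded_linear_inner_left ode_flow_deriv]
      by (simp add: has_real_derivative_iff_has_vector_derivative)
  qed (use assms in auto)
  then show ?thesis using assms by (simp add: inner_diff_left)
qed

lemma bounded_lipschitz_field_rescale:
  assumes "\<epsilon> > 0"
  shows "bounded_lipschitz_field (\<lambda>x t. G ((1/\<epsilon>) *\<^sub>R x) (t/\<epsilon>)) (L/\<epsilon>) B"
proof
  show "continuous_on UNIV (\<lambda>(x, t). G ((1/\<epsilon>) *\<^sub>R x) (t/\<epsilon>))"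
    unfolding case_prod_beta by (intro continuous_intros continuous_on_field) (use assms in auto)
  show "norm (G ((1/\<epsilon>) *\<^sub>R x) (t/\<epsilon>) - G ((1/\<epsilon>) *\<^sub>R y) (t/\<epsilon>)) \<le> L/\<epsilon> * norm (x - y)" for x y t
    using lip[of "(1/\<epsilon>) *\<^sub>R x" "t/\<epsilon>" "(1/\<epsilon>) *\<^sub>R y"] assms
    by (simp flip: scaleR_diff_right)
qed (use bound L_pos assms in auto)

text \<open>The factor \<epsilon> of the amplitude cancels the 1/\<epsilon> produced by the change
  of time. Through this identity a drift bound uniform in time becomes an error of order
  \<epsilon>.\<close>

lemma ode_flow_rescale:
  assumes \<epsilon>: "\<epsilon> > 0" and t: "t \<ge> 0"
  shows "ode_flow (\<lambda>x t. G ((1/\<epsilon>) *\<^sub>R x) (t/\<epsilon>)) t c = \<epsilon> *\<^sub>R ode_flow G (t/\<epsilon>) ((1/\<epsilon>) *\<^sub>R c)"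
proof -
  interpret r: bounded_lipschitz_field "\<lambda>x t. G ((1/\<epsilon>) *\<^sub>R x) (t/\<epsilon>)" "L/\<epsilon>" B
    by (rule bounded_lipschitz_field_rescale[OF \<epsilon>])
  let ?v = "\<lambda>t. ode_flow G t ((1/\<epsilon>) *\<^sub>R c)"
  have "is_ode_sol (\<lambda>x t. G ((1/\<epsilon>) *\<^sub>R x) (t/\<epsilon>)) c (\<lambda>t. \<epsilon> *\<^sub>R ?v (t/\<epsilon>))"
    unfolding is_ode_sol_def
  proof (intro conjI allI impI)
    fix t :: real assume t: "t \<ge> 0"
    have "(?v has_vector_derivative G (?v (t/\<epsilon>)) (t/\<epsilon>)) (at (t/\<epsilon>) within (\<lambda>t. t/\<epsilon>) ` {0..})"
      by (rule has_vector_derivative_within_subset[OF ode_flow_deriv]) (use t \<epsilon> in auto)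
    then have "((?v \<circ> (\<lambda>t. t/\<epsilon>)) has_vector_derivative (1/\<epsilon>) *\<^sub>R G (?v (t/\<epsilon>)) (t/\<epsilon>)) (at t within {0..})"
      by (intro vector_diff_chain_within)
        (use \<epsilon> in \<open>auto intro!: derivative_eq_intros
          simp: has_real_derivative_iff_has_vector_derivative[symmetric]\<close>)
    then have "((\<lambda>t. \<epsilon> *\<^sub>R ?v (t/\<epsilon>)) has_vector_derivative \<epsilon> *\<^sub>R (1/\<epsilon>) *\<^sub>R G (?v (t/\<epsilon>)) (t/\<epsilon>)) (at t within {0..})"
      unfolding o_def by (rule bounded_linear.has_vector_derivative[OF bounded_linear_scaleR_right])
    then show "((\<lambda>t. \<epsilon> *\<^sub>R ?v (t/\<epsilon>)) has_vector_derivative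
        G ((1/\<epsilon>) *\<^sub>R \<epsilon> *\<^sub>R ?v (t/\<epsilon>)) (t/\<epsilon>)) (at t within {0..})"
      using \<epsilon> by simp
  qed (use \<epsilon> in simp)
  then show ?thesis using r.ode_flow_eqI t by blast
qed

end

section \<open>Periodic fields\<close>

lemma lipschitz_wrt_pos_constant:
  assumes lip: "lipschitz_wrt N \<phi>" and N: "\<And>x. N x \<ge> 0"
  obtains C where "C > 0" "\<And>x y. \<bar>\<phi> x - \<phi> y\<bar> \<le> C * N (x - y)"
proof -
  obtain C where C: "\<And>x y. \<bar>\<phi> x - \<phi> y\<bar> \<le> C * N (x - y)"
    using lip unfolding lipschitz_wrt_def by blast
  have "\<bar>\<phi> x - \<phi> y\<bar> \<le> max C 1 * N (x - y)" for x y
    using C[of x y] mult_right_mono[OF max.cobounded1[of C 1] N[of "x - y"]] by linarith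
  then show ?thesis using that[of "max C 1"] by simp
qed

text \<open>The infimum is itself a Lipschitz constant: where \<open>N (x - y) > 0\<close> the
  difference quotient is a lower bound of the set, and where \<open>N (x - y) = 0\<close> any
  admissible constant forces \<open>\<phi> x = \<phi> y\<close>.\<close>

lemma
  assumes lip: "lipschitz_wrt N \<phi>" and N: "\<And>x. N x \<ge> 0"
  shows lip_const_nonneg: "lip_const N \<phi> \<ge> 0"
    and lip_const_bound: "\<bar>\<phi> x - \<phi> y\<bar> \<le> lip_const N \<phi> * N (x - y)"
proof -
  obtain C where C: "C > 0" "\<And>x y. \<bar>\<phi> x - \<phi> y\<bar> \<le> C * N (x - y)"
    using lipschitz_wrt_pos_constant[OF assms] by blast
  then have C': "C \<in> {C. C > 0 \<and> (\<forall>x y. \<bar>\<phi> x - \<phi> y\<bar> \<le> C * N (x - y))}" by simp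
  show "lip_const N \<phi> \<ge> 0"
    unfolding lip_const_def by (rule cInf_greatest) (use C' in auto)
  show "\<bar>\<phi> x - \<phi> y\<bar> \<le> lip_const N \<phi> * N (x - y)"
  proof (cases "N (x - y) = 0")
    case True
    then show ?thesis using C(2)[of x y] by simp
  next
    case False
    then have pos: "N (x - y) > 0" using N[of "x - y"] by linarith
    have "\<bar>\<phi> x - \<phi> y\<bar> / N (x - y) \<le> lip_const N \<phi>"
      unfolding lip_const_def
      by (rule cInf_greatest) (use C' pos in \<open>auto simp: divide_le_eq\<close>)
    then show ?thesis using pos by (simp add: divide_le_eq)
  qed
qed

text \<open>With \<open>x0\<close> the foot of the characteristic through \<open>x\<close>, the
  vector \<open>x0 - (x - t *\<^sub>R \<xi>)\<close> is exactly \<open>- \<epsilon>\<close> times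
  the unscaled drift error at time \<open>t/\<epsilon>\<close>. The norm stays abstract so that
  \<open>maxnorm\<close> and the absolute value share the argument.\<close>

lemma (in bounded_lipschitz_field) transport_sol_rescaled_error:
  assumes drift: "\<And>c \<tau>. \<tau> > 0 \<Longrightarrow> N (ode_flow G \<tau> c - c - \<tau> *\<^sub>R \<xi>) \<le> K"
    and N: "\<And>x. N x \<ge> 0" "\<And>a x. N (a *\<^sub>R x) = \<bar>a\<bar> * N x"
    and lip: "lipschitz_wrt N \<phi>" and \<epsilon>: "\<epsilon> > 0" and t: "t > 0"
  shows "\<bar>transport_sol \<phi> (\<lambda>u t. G ((1/\<epsilon>) *\<^sub>R u) (t/\<epsilon>)) x t - \<phi> (x - t *\<^sub>R \<xi>)\<bar>
    \<le> lip_const N \<phi> * K * \<epsilon>"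
proof -
  let ?G = "\<lambda>u t. G ((1/\<epsilon>) *\<^sub>R u) (t/\<epsilon>)"
  interpret r: bounded_lipschitz_field ?G "L/\<epsilon>" B
    by (rule bounded_lipschitz_field_rescale[OF \<epsilon>])
  obtain x0 where x0: "ode_flow ?G t x0 = x" using r.ode_flow_surj t by (meson less_imp_le)
  define c where "c = (1/\<epsilon>) *\<^sub>R x0"
  define y where "y = ode_flow G (t/\<epsilon>) c - c - (t/\<epsilon>) *\<^sub>R \<xi>"
  have "x = \<epsilon> *\<^sub>R ode_flow G (t/\<epsilon>) c"
    using ode_flow_rescale[OF \<epsilon>, of t x0] t x0 by (simp add: c_def)
  then have "x0 - (x - t *\<^sub>R \<xi>) = (- \<epsilon>) *\<^sub>R y"
    using \<epsilon> by (simp add: y_def c_def algebra_simps)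
  then have "N (x0 - (x - t *\<^sub>R \<xi>)) = \<epsilon> * N y"
    using N(2)[of "- \<epsilon>" y] \<epsilon> by simp
  also have "\<dots> \<le> \<epsilon> * K"
    unfolding y_def by (intro mult_left_mono drift) (use t \<epsilon> in auto)
  finally have *: "N (x0 - (x - t *\<^sub>R \<xi>)) \<le> \<epsilon> * K" .
  have "lip_const N \<phi> * N (x0 - (x - t *\<^sub>R \<xi>)) \<le> lip_const N \<phi> * (\<epsilon> * K)"
    by (intro mult_left_mono * lip_const_nonneg[OF lip N(1)])
  moreover have "transport_sol \<phi> ?G x t = \<phi> x0"
    using r.transport_sol_ode_flow[of t \<phi> x0] t x0 by simp
  ultimately show ?thesis
    using lip_const_bound[OF lip N(1), of x0 "x - t *\<^sub>R \<xi>"] by (simp add: mult_ac)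
qed

section \<open>Periodicity, cocycles and mean drift\<close>

lemma periodic_of_int:
  fixes v :: "'a::real_vector"
  assumes "\<And>x. f (x + v) = f x"
  shows "f (x + of_int k *\<^sub>R v) = f x"
proof (induction k rule: int_induct[where k=0])
  case (step1 i)
  have "f (x + of_int (i + 1) *\<^sub>R v) = f ((x + of_int i *\<^sub>R v) + v)"
    by (simp add: algebra_simps)
  with step1 show ?case using assms by metis
next
  case (step2 i)
  have "f (x + of_int (i - 1) *\<^sub>R v) = f ((x + of_int (i - 1) *\<^sub>R v) + v)" using assms by metis
  also have "\<dots> = f (x + of_int i *\<^sub>R v)" by (simp add: algebra_simps)
  finally show ?case using step2 by simp
qed simp

lemma periodic_int_vec:
  fixes f :: "real^'n \<Rightarrow> 'b"
  assumes per: "\<And>x i. f (x + axis i 1) = f x" and k: "k \<in> int_vec"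
  shows "f (x + k) = f x"
proof -
  have "f (x + (\<Sum>i\<in>I. (k $ i) *\<^sub>R axis i 1)) = f x" if "finite I" for I
    using that
  proof (induction I rule: finite_induct)
    case (insert i I)
    obtain z where z: "k $ i = of_int z" using k by (auto simp: int_vec_def elim: Ints_cases)
    have "f (x + (\<Sum>i\<in>insert i I. (k $ i) *\<^sub>R axis i 1))
        = f ((x + (\<Sum>i\<in>I. (k $ i) *\<^sub>R axis i 1)) + of_int z *\<^sub>R axis i 1)"
      using insert z by (simp add: algebra_simps)
    also have "\<dots> = f (x + (\<Sum>i\<in>I. (k $ i) *\<^sub>R axis i 1))"
      by (rule periodic_of_int) (rule per)
    finally show ?case using insert by simp
  qed simp
  from this[of UNIV] show ?thesis by (simp add: basis_expansion flip: scalar_mult_eq_scaleR)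
qed

text \<open>Subadditivity without suprema: \<open>a (l * m)\<close> is within \<open>l * K\<close> of \<open>l * a m\<close>, so the averages
  \<open>a m / m\<close> form a Cauchy sequence with the explicit rate \<open>K / m\<close>.\<close>

lemma cocycle_mean:
  fixes a :: "nat \<Rightarrow> 'b \<Rightarrow> real"
  assumes zero: "\<And>c. a 0 c = 0"
    and cocycle: "\<And>m l c. a (m + l) c = a m (T l c) + a l c"
    and osc: "\<And>m c c'. \<bar>a m c - a m c'\<bar> \<le> K"
  obtains \<xi> where "\<And>m c. \<bar>a m c - real m * \<xi>\<bar> \<le> K"
proof -
  have K: "K \<ge> 0" using osc[of 0] by (metis abs_ge_zero order.trans)
  \<comment> \<open>Among the \<open>l\<close> blocks of length \<open>m\<close> each starts at its
    own point; \<open>osc\<close> exchanges that point for \<open>c'\<close> at cost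
    \<open>K\<close> per block.\<close>
  have mult: "\<bar>a (l * m) c - real l * a m c'\<bar> \<le> real l * K" for l m c c'
  proof (induction l)
    case (Suc l)
    have "a (Suc l * m) c = a m (T (l * m) c) + a (l * m) c" using cocycle[of m "l * m"] by simp
    then show ?case using Suc osc[of m "T (l * m) c" c'] by (simp add: algebra_simps)
  qed (simp add: zero)
  have avg: "\<bar>a (l * m) c / real (l * m) - a m c' / real m\<bar> \<le> K / real m"
    if "l > 0" "m > 0" for l m c c'
  proof -
    have "a (l * m) c / real (l * m) - a m c' / real m = (a (l * m) c - real l * a m c') / real (l * m)"
      using that by (simp add: field_simps)
    also have "\<bar>\<dots>\<bar> \<le> (real l * K) / real (l * m)"
      unfolding abs_divide abs_of_nat by (rule divide_right_mono[OF mult]) simp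
    finally show ?thesis using that by simp
  qed
  define x where "x m = a (Suc m) undefined / real (Suc m)" for m
  have "Cauchy x"
  proof (rule CauchyI')
    fix e :: real assume e: "e > 0"
    obtain M where M: "real M > 2 * K / e" using reals_Archimedean2 by blast
    have "dist (x m) (x n) < e" if "m \<ge> M" "n > m" for m n
    proof -
      \<comment> \<open>Both averages are compared with the average over
        \<open>Suc m * Suc n\<close> steps.\<close>
      have "\<bar>x m - x n\<bar> \<le> K / real (Suc m) + K / real (Suc n)"
        using avg[of "Suc m" "Suc n" undefined undefined] avg[of "Suc n" "Suc m" undefined undefined]
        unfolding x_def mult.commute[of "Suc n" "Suc m"] by linarith
      also have "\<dots> \<le> K / real (Suc M) + K / real (Suc M)"
        using that K by (intro add_mono divide_left_mono) auto
      also have "\<dots> = 2 * K / real (Suc M)" by simp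
      also have "\<dots> < e"
      proof -
        have "2 * K < e * real (Suc M)" using M e by (simp add: field_simps)
        then show ?thesis by (simp add: divide_less_eq)
      qed
      finally show ?thesis by (simp add: dist_real_def)
    qed
    then show "\<exists>M. \<forall>m\<ge>M. \<forall>n>m. dist (x m) (x n) < e" by blast
  qed
  then obtain \<xi> where lim: "x \<longlonglongrightarrow> \<xi>" using Cauchy_convergent_iff convergent_def by blast
  have "\<bar>a m c - real m * \<xi>\<bar> \<le> K" for m c
  proof (cases "m = 0")
    case False
    \<comment> \<open>The sequence \<open>x\<close> starts with the average over one step, so the
      average over \<open>Suc l * m\<close> steps sits at index
      \<open>Suc l * m - 1\<close>.\<close>
    have sub: "strict_mono (\<lambda>l. Suc l * m - 1)"
      using False by (intro strict_monoI) (auto intro!: diff_less_mono)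
    have "(\<lambda>l. x (Suc l * m - 1)) \<longlonglongrightarrow> \<xi>"
      using LIMSEQ_subseq_LIMSEQ[OF lim sub] by (simp add: o_def)
    then have "(\<lambda>l. \<bar>x (Suc l * m - 1) - a m c / real m\<bar>) \<longlonglongrightarrow> \<bar>\<xi> - a m c / real m\<bar>"
      by (intro tendsto_intros)
    then have "\<bar>\<xi> - a m c / real m\<bar> \<le> K / real m"
    proof (rule LIMSEQ_le_const2, intro exI allI impI)
      fix l
      have "Suc (Suc l * m - 1) = Suc l * m" using False by simp
      then show "\<bar>x (Suc l * m - 1) - a m c / real m\<bar> \<le> K / real m"
        using avg[of "Suc l" m undefined c] False unfolding x_def by simp
    qed
    then have "real m * \<bar>\<xi> - a m c / real m\<bar> \<le> K" using False by (simp add: field_simps)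
    also have "real m * \<bar>\<xi> - a m c / real m\<bar> = \<bar>real m * (\<xi> - a m c / real m)\<bar>"
      by (simp add: abs_mult)
    also have "\<dots> = \<bar>a m c - real m * \<xi>\<bar>" using False by (simp add: right_diff_distrib)
    finally show ?thesis .
  qed (simp add: zero K)
  then show ?thesis by (rule that)
qed

context bounded_lipschitz_field
begin

text \<open>The sampling step \<open>s\<close> is kept free: fields of period 1 in time use
  \<open>s = 1\<close>, autonomous ones every positive \<open>s\<close>. The semigroup law at
  multiples of a period makes the displacement a cocycle, and dividing its mean per step by
  \<open>s\<close> gives a speed per unit time.\<close>

lemma stroboscopic_drift:
  assumes per: "\<And>x t. G x (t + s) = G x t" and s: "s > 0"
    and osc: "\<And>t c c'. t > 0 \<Longrightarrow>
      \<bar>(ode_flow G t c - c) \<bullet> b - (ode_flow G t c' - c') \<bullet> b\<bar> \<le> K"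
    and K: "K \<ge> 0"
  obtains \<xi> where "\<And>m c. \<bar>(ode_flow G (real m * s) c - c) \<bullet> b - real m * s * \<xi>\<bar> \<le> K"
proof -
  have per': "G x (t + real m * s) = G x t" for x t m
    using periodic_of_int[of "G x" s t "int m"] per by simp
  obtain \<xi> where \<xi>: "\<And>m c. \<bar>(ode_flow G (real m * s) c - c) \<bullet> b - real m * \<xi>\<bar> \<le> K"
  proof (rule cocycle_mean[where a="\<lambda>m c. (ode_flow G (real m * s) c - c) \<bullet> b"
        and T="\<lambda>l c. ode_flow G (real l * s) c" and K=K])
    fix m l c
    have "ode_flow G (real (m + l) * s) c = ode_flow G (real m * s) (ode_flow G (real l * s) c)"
      using ode_flow_time_shift[OF per', of l "real m * s" c] s by (simp add: algebra_simps)
    then show "(ode_flow G (real (m + l) * s) c - c) \<bullet> b =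
        (ode_flow G (real m * s) (ode_flow G (real l * s) c) - ode_flow G (real l * s) c) \<bullet> b
        + (ode_flow G (real l * s) c - c) \<bullet> b"
      by (simp add: inner_diff_left)
  next
    fix m c c'
    show "\<bar>(ode_flow G (real m * s) c - c) \<bullet> b - (ode_flow G (real m * s) c' - c') \<bullet> b\<bar> \<le> K"
      by (cases "m = 0") (use osc[of "real m * s"] s K in auto)
  qed auto
  show ?thesis by (rule that[of "\<xi> / s"]) (use \<xi> s in simp)
qed

text \<open>Of the extra \<open>2 * M\<close>, one \<open>M\<close> covers the motion between the
  integer part of \<open>t\<close> and \<open>t\<close>, the other the linear term over the same
  stretch, for which |\<xi>| \<le> M has to be known.\<close>

lemma periodic_drift:
  assumes per: "\<And>x t. G x (t + 1) = G x t"
    and osc: "\<And>t c c'. t > 0 \<Longrightarrow>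
      \<bar>(ode_flow G t c - c) \<bullet> b - (ode_flow G t c' - c') \<bullet> b\<bar> \<le> K"
    and K: "K \<ge> 0"
    and M: "\<And>x t. \<bar>G x t \<bullet> b\<bar> \<le> M"
  obtains \<xi> where "\<And>t c. t \<ge> 0 \<Longrightarrow> \<bar>(ode_flow G t c - c) \<bullet> b - t * \<xi>\<bar> \<le> K + 2 * M"
proof -
  obtain \<xi> where \<xi>: "\<And>m c. \<bar>(ode_flow G (real m) c - c) \<bullet> b - real m * \<xi>\<bar> \<le> K"
    using stroboscopic_drift[OF per _ osc K] by auto
  \<comment> \<open>The displacement at time \<open>m\<close> is at most \<open>M * m\<close> and
    lies within \<open>K\<close> of \<open>m * \<xi>\<close>; a larger slope would contradict this
    for large \<open>m\<close>.\<close>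
  have speed: "\<bar>\<xi>\<bar> \<le> M"
  proof (rule ccontr)
    assume "\<not> \<bar>\<xi>\<bar> \<le> M"
    then have pos: "\<bar>\<xi>\<bar> - M > 0" by simp
    obtain m where m: "real m > K / (\<bar>\<xi>\<bar> - M)" using reals_Archimedean2 by blast
    have "real m * \<bar>\<xi>\<bar> = \<bar>real m * \<xi>\<bar>" by (simp add: abs_mult)
    also have "\<dots> \<le> K + M * real m"
      using \<xi>[of m 0] ode_flow_displacement[OF M, of 0 "real m" 0] by simp
    finally have "real m * (\<bar>\<xi>\<bar> - M) \<le> K" by (simp add: algebra_simps)
    with m pos show False by (simp add: field_simps)
  qed
  have "\<bar>(ode_flow G t c - c) \<bullet> b - t * \<xi>\<bar> \<le> K + 2 * M" if t: "t \<ge> 0" for t c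
  proof -
    define m where "m = nat \<lfloor>t\<rfloor>"
    define r where "r = t - real m"
    have r: "0 \<le> r" "r \<le> 1" using t unfolding r_def m_def by (auto simp: nat_eq_iff) linarith+
    have "\<bar>(ode_flow G t c - ode_flow G (real m) c) \<bullet> b\<bar> \<le> M * r"
      using ode_flow_displacement[OF M, of "real m" t c] r unfolding r_def by simp
    moreover have "\<bar>r * \<xi>\<bar> \<le> M * r"
      using mult_right_mono[OF speed r(1)] r by (simp add: abs_mult mult.commute)
    moreover have "M * r \<le> M" using r speed by (simp add: mult_left_le)
    moreover have "(ode_flow G t c - c) \<bullet> b - t * \<xi>
        = ((ode_flow G (real m) c - c) \<bullet> b - real m * \<xi>)
          + (ode_flow G t c - ode_flow G (real m) c) \<bullet> b - r * \<xi>"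
      unfolding r_def by (simp add: inner_diff_left algebra_simps)
    ultimately show ?thesis using \<xi>[of m c] by linarith
  qed
  then show ?thesis by (rule that)
qed

end

section \<open>The maximum norm and fields on the torus\<close>

lemma maxnorm_ge: "\<bar>x $ i\<bar> \<le> maxnorm x"
  unfolding maxnorm_def by (rule Max_ge) auto

lemma maxnorm_le: "(\<And>i. \<bar>x $ i\<bar> \<le> a) \<Longrightarrow> maxnorm x \<le> a"
  unfolding maxnorm_def by (subst Max_le_iff) auto

lemma maxnorm_nonneg: "maxnorm x \<ge> 0"
  using maxnorm_ge[of x undefined] by (meson abs_ge_zero order.trans)

lemma maxnorm_scaleR: "maxnorm (a *\<^sub>R x) = \<bar>a\<bar> * maxnorm x"
proof -
  have "range (\<lambda>i. \<bar>(a *\<^sub>R x) $ i\<bar>) = (\<lambda>y. \<bar>a\<bar> * y) ` range (\<lambda>i. \<bar>x $ i\<bar>)"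
    by (auto simp: abs_mult)
  moreover have "\<bar>a\<bar> * Max (range (\<lambda>i. \<bar>x $ i\<bar>)) = Max ((\<lambda>y. \<bar>a\<bar> * y) ` range (\<lambda>i. \<bar>x $ i\<bar>))"
    by (rule mono_Max_commute) (auto intro!: monoI mult_left_mono)
  ultimately show ?thesis unfolding maxnorm_def by simp
qed

lemma norm_le_maxnorm: "norm (x::real^'n) \<le> real CARD('n) * maxnorm x"
proof -
  have "norm x \<le> (\<Sum>i\<in>UNIV. \<bar>x $ i\<bar>)" by (rule norm_le_l1_cart)
  also have "\<dots> \<le> (\<Sum>i\<in>(UNIV::'n set). maxnorm x)" by (intro sum_mono maxnorm_ge)
  finally show ?thesis by simp
qed

lemma maxnorm_le_norm: "maxnorm x \<le> norm x"
  by (rule maxnorm_le) (rule component_le_norm_cart)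

lemma floor_vec_int_vec: "(\<chi> j. of_int \<lfloor>r $ j\<rfloor>) \<in> int_vec"
  by (simp add: int_vec_def)

lemma homogenization_error_torus:
  fixes f :: "real^'n \<Rightarrow> real \<Rightarrow> real^'n"
  assumes cont: "continuous_on UNIV (\<lambda>(r,\<tau>). f r \<tau>)"
    and lip: "\<And>r r' \<tau> \<tau>'. maxnorm (f r \<tau> - f r' \<tau>') \<le> \<kappa> * max (maxnorm (r - r')) \<bar>\<tau> - \<tau>'\<bar>"
    and per_x: "\<And>r \<tau> i. f (r + axis i 1) \<tau> = f r \<tau>"
    and per_t: "\<And>r \<tau>. f r (\<tau> + 1) = f r \<tau>"
    and C0: "C0 > 0"
    and close: "\<And>c1 c2 i \<tau>. \<tau> > 0 \<Longrightarrow> (\<And>j. 0 \<le> (c1 - c2) $ j \<and> (c1 - c2) $ j \<le> 1) \<Longrightarrow>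
      ode_flow f \<tau> c2 $ i - ode_flow f \<tau> c1 $ i \<le> C0"
  obtains \<xi> where "\<And>\<phi> \<epsilon> t x. lipschitz_wrt maxnorm \<phi> \<Longrightarrow> \<epsilon> > 0 \<Longrightarrow> t > 0 \<Longrightarrow>
    \<bar>transport_sol \<phi> (\<lambda>u t. f ((1/\<epsilon>) *\<^sub>R u) (t/\<epsilon>)) x t - \<phi> (x - t *\<^sub>R \<xi>)\<bar>
      \<le> lip_const maxnorm \<phi> *
        (1 + C0 + 2 * Max (range (\<lambda>i. SUP p\<in>UNIV. \<bar>f (fst p) (snd p) $ i\<bar>))) * \<epsilon>"
proof -
  have per_int: "f (r + k) = f r" if "k \<in> int_vec" for r k
    by (rule periodic_int_vec[OF _ that]) (use per_x in auto)
  \<comment> \<open>Periodicity in space and time moves every argument into the unit cube, where the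
    Lipschitz estimate controls the distance from \<open>f 0 0\<close>.\<close>
  define B where "B = maxnorm (f 0 0) + \<bar>\<kappa>\<bar>"
  have bnd: "\<bar>f r \<tau> $ i\<bar> \<le> B" for r \<tau> i
  proof -
    define r' where "r' = (\<chi> j. frac (r $ j))"
    have "r' + (\<chi> j. of_int \<lfloor>r $ j\<rfloor>) = r" by (simp add: r'_def vec_eq_iff frac_def)
    then have "f r = f r'" using per_int[OF floor_vec_int_vec[of r], of r'] by simp
    moreover have "f r' (frac \<tau>) = f r' \<tau>"
      using periodic_of_int[of "f r'" 1 "frac \<tau>" "\<lfloor>\<tau>\<rfloor>"] per_t by (simp add: frac_def)
    ultimately have eq: "f r \<tau> = f r' (frac \<tau>)" by simp
    have "maxnorm r' \<le> 1"
      by (rule maxnorm_le) (auto simp: r'_def intro: less_imp_le[OF frac_lt_1])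
    then have m: "max (maxnorm (r' - 0)) \<bar>frac \<tau> - 0\<bar> \<le> 1"
      by (auto intro: less_imp_le[OF frac_lt_1])
    have "maxnorm (f r' (frac \<tau>) - f 0 0) \<le> \<kappa> * max (maxnorm (r' - 0)) \<bar>frac \<tau> - 0\<bar>" by (rule lip)
    also have "\<dots> \<le> \<bar>\<kappa>\<bar> * 1"
      by (intro mult_mono m) (auto simp: maxnorm_nonneg le_max_iff_disj)
    finally show ?thesis
      unfolding eq B_def using maxnorm_ge[of "f r' (frac \<tau>) - f 0 0" i] maxnorm_ge[of "f 0 0" i]
      by (simp add: abs_le_iff)
  qed
  interpret bounded_lipschitz_field f "real CARD('n) * \<bar>\<kappa>\<bar> + 1" "real CARD('n) * B"
  proof
    show "norm (f x t - f y t) \<le> (real CARD('n) * \<bar>\<kappa>\<bar> + 1) * norm (x - y)" for x y t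
    proof -
      have "norm (f x t - f y t) \<le> real CARD('n) * maxnorm (f x t - f y t)" by (rule norm_le_maxnorm)
      also have "maxnorm (f x t - f y t) \<le> \<kappa> * maxnorm (x - y)"
        using lip[of x t y t] by (simp add: maxnorm_nonneg max_absorb1)
      also have "\<kappa> * maxnorm (x - y) \<le> \<bar>\<kappa>\<bar> * norm (x - y)"
        by (intro mult_mono maxnorm_le_norm) (auto simp: maxnorm_nonneg)
      finally show ?thesis by (simp add: algebra_simps mult_left_mono add_increasing)
    qed
    show "norm (f x t) \<le> real CARD('n) * B" for x t
      by (rule order.trans[OF norm_le_maxnorm]) (intro mult_left_mono maxnorm_le bnd, auto)
  qed (use cont in \<open>auto intro: add_nonneg_pos\<close>)
  define M where "M = Max (range (\<lambda>i. SUP p\<in>UNIV. \<bar>f (fst p) (snd p) $ i\<bar>))"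
  have M: "\<bar>f r \<tau> \<bullet> axis i 1\<bar> \<le> M" for r \<tau> i
  proof -
    have "\<bar>f r \<tau> $ i\<bar> \<le> (SUP p\<in>UNIV. \<bar>f (fst p) (snd p) $ i\<bar>)"
      by (rule cSUP_upper2[where x="(r, \<tau>)"]) (auto intro!: bdd_aboveI2 bnd)
    also have "\<dots> \<le> M" unfolding M_def by (rule Max_ge) auto
    finally show ?thesis by (simp add: inner_axis)
  qed
  \<comment> \<open>The hypothesis compares only starting points whose difference lies in the unit
    cube. Translating \<open>c2\<close> by the integer part \<open>k\<close> of
    \<open>c1 - c2\<close> leads to that case without changing the displacement; the fractional part
    left over costs at most 1. Exchanging \<open>c1\<close> and \<open>c2\<close> afterwards makes
    the estimate two-sided.\<close>
  have half: "(ode_flow f t c2 - c2) $ i - (ode_flow f t c1 - c1) $ i \<le> 1 + C0"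
    if "t > 0" for t c1 c2 i
  proof -
    define k :: "real^'n" where "k = (\<chi> j. of_int \<lfloor>(c1 - c2) $ j\<rfloor>)"
    have k: "k \<in> int_vec" unfolding k_def by (rule floor_vec_int_vec)
    have "ode_flow f t (c2 + k) = ode_flow f t c2 + k"
      by (rule ode_flow_space_shift) (use per_int[OF k] that in auto)
    moreover have "ode_flow f t (c2 + k) $ i - ode_flow f t c1 $ i \<le> C0"
    proof (rule close[OF that])
      fix j
      have "(c1 - (c2 + k)) $ j = frac ((c1 - c2) $ j)" by (simp add: k_def frac_def)
      then show "0 \<le> (c1 - (c2 + k)) $ j \<and> (c1 - (c2 + k)) $ j \<le> 1"
        by (simp add: less_imp_le[OF frac_lt_1])
    qed
    moreover have "(c1 - c2) $ i - k $ i \<le> 1" unfolding k_def by simp linarith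
    ultimately show ?thesis by simp
  qed
  \<comment> \<open>Each coordinate gets its own drift. Assembling them into a vector costs nothing
    in the constant, since the error is measured in the maximum norm.\<close>
  have "\<exists>\<xi>. \<forall>t\<ge>0. \<forall>c. \<bar>(ode_flow f t c - c) \<bullet> axis i 1 - t * \<xi>\<bar> \<le> (1 + C0) + 2 * M" for i
  proof (rule periodic_drift[where b="axis i 1" and K="1 + C0" and M=M])
    show "\<bar>(ode_flow f t c - c) \<bullet> axis i 1 - (ode_flow f t c' - c') \<bullet> axis i 1\<bar> \<le> 1 + C0"
      if "t > 0" for t c c'
      using half[OF that, of c i c'] half[OF that, of c' i c] by (simp add: inner_axis abs_le_iff)
  qed (use per_t C0 M in auto)
  then obtain \<xi> where \<xi>: "\<And>t c i. t \<ge> 0 \<Longrightarrow>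
      \<bar>(ode_flow f t c - c) \<bullet> axis i 1 - t * \<xi> i\<bar> \<le> (1 + C0) + 2 * M"
    by metis
  show ?thesis
  proof (rule that[of "\<chi> i. \<xi> i"], fold M_def)
    show "\<bar>transport_sol \<phi> (\<lambda>u t. f ((1/\<epsilon>) *\<^sub>R u) (t/\<epsilon>)) x t - \<phi> (x - t *\<^sub>R (\<chi> i. \<xi> i))\<bar>
      \<le> lip_const maxnorm \<phi> * (1 + C0 + 2 * M) * \<epsilon>"
      if "lipschitz_wrt maxnorm \<phi>" "\<epsilon> > 0" "t > 0" for \<phi> \<epsilon> t x
    proof (rule transport_sol_rescaled_error[OF _ maxnorm_nonneg maxnorm_scaleR that])
      show "maxnorm (ode_flow f \<tau> c - c - \<tau> *\<^sub>R (\<chi> i. \<xi> i)) \<le> 1 + C0 + 2 * M" if "\<tau> > 0" for c \<tau>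
        by (rule maxnorm_le) (use \<xi>[of \<tau> c] that in \<open>auto simp: inner_axis\<close>)
    qed
  qed
qed

section \<open>Scalar periodic fields\<close>

lemma (in bounded_lipschitz_field) ode_flow_continuous_on: "continuous_on {0..} (\<lambda>t. ode_flow G t c)"
  unfolding continuous_on_eq_continuous_within
  using ode_flow_deriv has_vector_derivative_continuous by (metis atLeast_iff)

locale scalar_periodic_field = bounded_lipschitz_field G L B
  for G :: "real \<Rightarrow> real \<Rightarrow> real" and L B +
  assumes periodic: "G (r + 1) t = G r t"
begin

text \<open>Trajectories on the line that change their order meet at some time by the intermediate
  value theorem, and the flow is injective at every time.\<close>

lemma ode_flow_mono:
  assumes "c \<le> c'" "t \<ge> 0"
  shows "ode_flow G t c \<le> ode_flow G t c'"
proof (rule ccontr)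
  assume "\<not> ?thesis"
  moreover have "continuous_on {0..t} (\<lambda>s. ode_flow G s c - ode_flow G s c')"
    by (intro continuous_intros continuous_on_subset[OF ode_flow_continuous_on]) auto
  ultimately obtain s where "0 \<le> s" "s \<le> t" "ode_flow G s c - ode_flow G s c' = 0"
    using IVT'[of "\<lambda>s. ode_flow G s c - ode_flow G s c'" 0 0 t] assms by auto
  then have "c = c'" using ode_flow_inj[of s c c'] by simp
  with \<open>\<not> ?thesis\<close> show False by simp
qed

text \<open>Monotonicity replaces the closeness hypothesis of the higher-dimensional case:
  \<open>c\<close> lies between the translates of \<open>c'\<close> by \<open>k\<close> and
  \<open>k + 1\<close>, and the images of these translates again differ by exactly 1.\<close>

lemma displacement_oscillation:
  assumes "t \<ge> 0"
  shows "\<bar>(ode_flow G t c - c) - (ode_flow G t c' - c')\<bar> \<le> 1"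
proof -
  have shift: "ode_flow G t (c' + of_int k) = ode_flow G t c' + of_int k" for k
    by (rule ode_flow_space_shift)
      (use periodic_of_int[of G 1] periodic assms in \<open>auto simp: fun_eq_iff\<close>)
  define k where "k = \<lfloor>c - c'\<rfloor>"
  have k: "of_int k \<le> c - c'" "c - c' \<le> of_int k + 1" unfolding k_def by linarith+
  have "ode_flow G t (c' + of_int k) \<le> ode_flow G t c"
    "ode_flow G t c \<le> ode_flow G t (c' + of_int (k + 1))"
    by (intro ode_flow_mono; use k assms in simp)+
  then show ?thesis unfolding shift using k by simp
qed

end

lemma homogenization_error_circle:
  fixes f :: "real \<Rightarrow> real \<Rightarrow> real"
  assumes cont: "continuous_on UNIV (\<lambda>(r,\<tau>). f r \<tau>)"
    and lip: "\<And>r r' \<tau> \<tau>'. \<bar>f r \<tau> - f r' \<tau>'\<bar> \<le> \<kappa> * max \<bar>r - r'\<bar> \<bar>\<tau> - \<tau>'\<bar>"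
    and per_x: "\<And>r \<tau>. f (r + 1) \<tau> = f r \<tau>"
    and per_t: "\<And>r \<tau>. f r (\<tau> + 1) = f r \<tau>"
  obtains \<xi> where "\<And>\<phi> \<epsilon> t x. lipschitz_wrt abs \<phi> \<Longrightarrow> \<epsilon> > 0 \<Longrightarrow> t > 0 \<Longrightarrow>
      \<bar>transport_sol \<phi> (\<lambda>u t. f (u/\<epsilon>) (t/\<epsilon>)) x t - \<phi> (x - \<xi> * t)\<bar>
        \<le> lip_const abs \<phi> * (1 + 2 * (SUP p\<in>UNIV. \<bar>f (fst p) (snd p)\<bar>)) * \<epsilon>"
    and "\<And>\<phi> \<epsilon> t x. \<forall>r \<tau> \<tau>'. f r \<tau> = f r \<tau>' \<Longrightarrow>
      lipschitz_wrt abs \<phi> \<Longrightarrow> \<epsilon> > 0 \<Longrightarrow> t > 0 \<Longrightarrow>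
      \<bar>transport_sol \<phi> (\<lambda>u t. f (u/\<epsilon>) (t/\<epsilon>)) x t - \<phi> (x - \<xi> * t)\<bar>
        \<le> lip_const abs \<phi> * \<epsilon>"
proof -
  have bnd: "\<bar>f r \<tau>\<bar> \<le> \<bar>f 0 0\<bar> + \<bar>\<kappa>\<bar>" for r \<tau>
  proof -
    have "f (frac r) = f r"
      using periodic_of_int[of f 1 "frac r" "\<lfloor>r\<rfloor>"] per_x by (simp add: frac_def fun_eq_iff)
    moreover have "f r (frac \<tau>) = f r \<tau>"
      using periodic_of_int[of "f r" 1 "frac \<tau>" "\<lfloor>\<tau>\<rfloor>"] per_t by (simp add: frac_def)
    ultimately have eq: "f r \<tau> = f (frac r) (frac \<tau>)" by simp
    have "\<bar>f (frac r) (frac \<tau>) - f 0 0\<bar> \<le> \<kappa> * max \<bar>frac r - 0\<bar> \<bar>frac \<tau> - 0\<bar>" by (rule lip)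
    also have "\<dots> \<le> \<bar>\<kappa>\<bar> * 1"
      by (intro mult_mono) (auto simp: le_max_iff_disj intro: less_imp_le[OF frac_lt_1])
    finally show ?thesis unfolding eq by linarith
  qed
  interpret scalar_periodic_field f "\<bar>\<kappa>\<bar> + 1" "\<bar>f 0 0\<bar> + \<bar>\<kappa>\<bar>"
  proof
    show "norm (f x t - f y t) \<le> (\<bar>\<kappa>\<bar> + 1) * norm (x - y)" for x y t
    proof -
      have "\<bar>f x t - f y t\<bar> \<le> \<kappa> * \<bar>x - y\<bar>" using lip[of x t y t] by simp
      also have "\<dots> \<le> (\<bar>\<kappa>\<bar> + 1) * \<bar>x - y\<bar>" by (intro mult_right_mono) auto
      finally show ?thesis by simp
    qed
  qed (use cont bnd per_x in auto)
  define M where "M = (SUP p\<in>UNIV. \<bar>f (fst p) (snd p)\<bar>)"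
  have M: "\<bar>f r \<tau> \<bullet> 1\<bar> \<le> M" for r \<tau>
    unfolding M_def by (rule cSUP_upper2[where x="(r, \<tau>)"]) (auto intro!: bdd_aboveI2 bnd)
  have osc: "\<bar>(ode_flow f t c - c) \<bullet> 1 - (ode_flow f t c' - c') \<bullet> 1\<bar> \<le> 1" if "t > 0" for t c c'
    using displacement_oscillation[of t c c'] that by simp
  obtain \<xi> where \<xi>: "\<And>t c. t \<ge> 0 \<Longrightarrow> \<bar>(ode_flow f t c - c) \<bullet> 1 - t * \<xi>\<bar> \<le> 1 + 2 * M"
    using periodic_drift[OF per_t osc _ M] by auto
  have transport: "\<bar>transport_sol \<phi> (\<lambda>u t. f (u/\<epsilon>) (t/\<epsilon>)) x t - \<phi> (x - \<xi> * t)\<bar> \<le> lip_const abs \<phi> * K * \<epsilon>"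
    if "\<And>\<tau> c. \<tau> > 0 \<Longrightarrow> \<bar>ode_flow f \<tau> c - c - \<tau> * \<xi>\<bar> \<le> K"
      and "lipschitz_wrt abs \<phi>" "\<epsilon> > 0" "t > 0" for K \<phi> \<epsilon> t x
    using transport_sol_rescaled_error[of abs \<xi> K \<phi> \<epsilon> t x] that
    by (simp add: abs_mult mult.commute)
  show ?thesis
  proof (rule that[of \<xi>], fold M_def)
    show "\<bar>transport_sol \<phi> (\<lambda>u t. f (u/\<epsilon>) (t/\<epsilon>)) x t - \<phi> (x - \<xi> * t)\<bar> \<le> lip_const abs \<phi> * (1 + 2 * M) * \<epsilon>"
      if "lipschitz_wrt abs \<phi>" "\<epsilon> > 0" "t > 0" for \<phi> \<epsilon> t x
      by (rule transport[OF _ that]) (use \<xi> in simp)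
  next
    fix \<phi> :: "real \<Rightarrow> real" and \<epsilon> t x :: real
    assume autonomous: "\<forall>r \<tau> \<tau>'. f r \<tau> = f r \<tau>'"
      and *: "lipschitz_wrt abs \<phi>" "\<epsilon> > 0" "t > 0"
    have "\<bar>ode_flow f s c - c - s * \<xi>\<bar> \<le> 1" if s: "s > 0" for s c
    proof -
      \<comment> \<open>an autonomous field has every period \<open>s\<close>, and the mean speed does not depend on \<open>s\<close>\<close>
      obtain \<zeta> where \<zeta>: "\<And>m c. \<bar>(ode_flow f (real m * s) c - c) \<bullet> 1 - real m * s * \<zeta>\<bar> \<le> 1"
        using stroboscopic_drift[OF autonomous[rule_format] s osc] by auto
      have "\<zeta> = \<xi>"
      proof (rule ccontr)
        assume "\<zeta> \<noteq> \<xi>"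
        then have pos: "s * \<bar>\<zeta> - \<xi>\<bar> > 0" using s by simp
        \<comment> \<open>The numerator adds the error 1 of \<open>\<zeta>\<close> to the error
          \<open>1 + 2 * M\<close> of \<open>\<xi>\<close> at the common time \<open>m * s\<close>;
          two linear functions this close along all multiples of \<open>s\<close> have equal
          slopes.\<close>
        obtain m where m: "real m > (2 + 2 * M) / (s * \<bar>\<zeta> - \<xi>\<bar>)" using reals_Archimedean2 by blast
        have "real m * (s * \<bar>\<zeta> - \<xi>\<bar>) = \<bar>real m * s * \<zeta> - real m * s * \<xi>\<bar>"
          using s by (simp add: abs_mult flip: right_diff_distrib)
        also have "\<dots> \<le> 2 + 2 * M"
          using \<zeta>[of m 0] \<xi>[of "real m * s" 0] s by (simp add: abs_le_iff)
        finally show False using m pos by (simp add: field_simps)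
      qed
      \<comment> \<open>For one step the sampling time is \<open>s\<close> itself, so no fractional
        period remains and the bound stays 1.\<close>
      with \<zeta>[of 1 c] show ?thesis by simp
    qed
    then show "\<bar>transport_sol \<phi> (\<lambda>u t. f (u/\<epsilon>) (t/\<epsilon>)) x t - \<phi> (x - \<xi> * t)\<bar>
        \<le> lip_const abs \<phi> * \<epsilon>"
      using transport[of 1 \<phi> \<epsilon> t x] * by simp
  qed
qed

section \<open>Discrete Fourier coefficients of periodic functions\<close>

lemma differentiable_on_UNIV_at:
  "F differentiable_on UNIV \<Longrightarrow> (F has_derivative frechet_derivative F (at x)) (at x)"
  unfolding differentiable_on_def using frechet_derivative_works by auto

lemma Ck_SucI:
  assumes "\<And>x. (F has_derivative D x) (at x)" "\<And>i. Ck m (\<lambda>x. D x (axis i 1))"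
  shows "Ck (Suc m) F"
proof -
  have "frechet_derivative F (at x) = D x" for x
    using frechet_derivative_at[OF assms(1)] by simp
  moreover have "F differentiable_on UNIV"
    using assms(1) by (auto simp: differentiable_on_def differentiable_def)
  ultimately show ?thesis
    using assms(2) by (simp add: differentiable_imp_continuous_on)
qed

lemma Ck_SucD: "Ck (Suc m) F \<Longrightarrow> Ck m F"
  by (induction m arbitrary: F) auto

lemma Ck_continuous_on: "Ck m F \<Longrightarrow> continuous_on UNIV F"
  by (cases m) auto

lemma Ck_deriv:
  assumes "Ck (Suc m) F"
  shows "(F has_derivative frechet_derivative F (at x)) (at x)"
    and "Ck m (\<lambda>x. frechet_derivative F (at x) (axis i 1))"
  using assms differentiable_on_UNIV_at by auto

lemma Ck_const: "Ck m (\<lambda>x. c)"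
proof (induction m arbitrary: c)
  case (Suc m)
  show ?case by (rule Ck_SucI[where D="\<lambda>_ _. 0"]) (auto intro: Suc)
qed auto

lemma Ck_add: "Ck m F \<Longrightarrow> Ck m G \<Longrightarrow> Ck m (\<lambda>x. F x + G x)"
proof (induction m arbitrary: F G)
  case 0
  then show ?case by (auto intro: continuous_intros)
next
  case (Suc m)
  show ?case
    by (rule Ck_SucI[OF has_derivative_add[OF Ck_deriv(1)[OF Suc.prems(1)] Ck_deriv(1)[OF Suc.prems(2)]]])
      (intro Suc.IH Ck_deriv(2) Suc.prems)
qed

lemma Ck_mult: "Ck m F \<Longrightarrow> Ck m G \<Longrightarrow> Ck m (\<lambda>x. F x * G x)"
proof (induction m arbitrary: F G)
  case 0
  then show ?case by (auto intro: continuous_intros)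
next
  case (Suc m)
  show ?case
    by (rule Ck_SucI[OF has_derivative_mult[OF Ck_deriv(1)[OF Suc.prems(1)] Ck_deriv(1)[OF Suc.prems(2)]]])
      (intro Ck_add Suc.IH Ck_deriv(2) Ck_SucD[OF Suc.prems(1)] Ck_SucD[OF Suc.prems(2)] Suc.prems)
qed

text \<open>The derivative of 1/F is -F'/F^2, a product of F' with two copies of 1/F, so the
  induction hypothesis one order lower closes the step. The reciprocal is needed because its
  primitive along the line measures travel time.\<close>

lemma Ck_inverse: "Ck m F \<Longrightarrow> (\<And>x. F x \<noteq> 0) \<Longrightarrow> Ck m (\<lambda>x. inverse (F x))"
proof (induction m arbitrary: F)
  case 0
  then show ?case by (auto intro: continuous_intros)
next
  case (Suc m)
  have "((\<lambda>x. inverse (F x)) has_derivative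
      (\<lambda>h. (-1) * (frechet_derivative F (at x) h * (inverse (F x) * inverse (F x))))) (at x)" for x
    by (rule has_derivative_eq_rhs[OF Deriv.has_derivative_inverse[OF Suc.prems(2) Ck_deriv(1)[OF Suc.prems(1)]]])
      (simp add: mult_ac)
  then show ?case
    by (rule Ck_SucI) (intro Ck_mult Ck_const Ck_deriv(2) Suc Ck_SucD[OF Suc.prems(1)])
qed

definition lattice_periodic :: "(real^'d \<Rightarrow> 'b) \<Rightarrow> bool" where
  "lattice_periodic F \<longleftrightarrow> (\<forall>x. \<forall>k\<in>int_vec. F (x + k) = F x)"

lemma lattice_periodic_frechet_derivative:
  assumes F: "\<And>x. (F has_derivative frechet_derivative F (at x)) (at x)" and per: "lattice_periodic F"
  shows "lattice_periodic (\<lambda>x. frechet_derivative F (at x) v)"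
  unfolding lattice_periodic_def
proof (intro allI ballI)
  fix x k :: "real^'a" assume k: "k \<in> int_vec"
  have "((F \<circ> (\<lambda>x. x + k)) has_derivative (frechet_derivative F (at (x + k)) \<circ> (\<lambda>h. h))) (at x)"
    by (intro diff_chain_at F) (auto intro!: derivative_eq_intros)
  moreover have "F \<circ> (\<lambda>x. x + k) = F" using per k by (auto simp: lattice_periodic_def)
  ultimately have "(F has_derivative frechet_derivative F (at (x + k))) (at x)" by (simp add: o_def)
  then show "frechet_derivative F (at (x + k)) v = frechet_derivative F (at x) v"
    using frechet_derivative_at by metis
qed

lemma lattice_periodic_bounded:
  fixes F :: "real^'d \<Rightarrow> real"
  assumes per: "lattice_periodic F" and cont: "continuous_on UNIV F"
  obtains A where "A > 0" "\<And>x. \<bar>F x\<bar> \<le> A"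
proof -
  have "bounded (F ` cbox 0 1)"
    by (intro compact_imp_bounded compact_continuous_image continuous_on_subset[OF cont]) auto
  then obtain A where A: "\<And>x. x \<in> cbox 0 1 \<Longrightarrow> \<bar>F x\<bar> \<le> A"
    unfolding bounded_iff by auto
  have "\<bar>F x\<bar> \<le> max A 1" for x
  proof -
    define y :: "real^'d" where "y = (\<chi> j. frac (x $ j))"
    have "y + (\<chi> j. of_int \<lfloor>x $ j\<rfloor>) = x" by (simp add: y_def vec_eq_iff frac_def)
    then have "F x = F y" using per floor_vec_int_vec[of x] unfolding lattice_periodic_def by metis
    moreover have "y \<in> cbox 0 1"
      by (auto simp: mem_box_cart y_def intro: less_imp_le[OF frac_lt_1])
    ultimately show ?thesis using A[of y] by simp
  qed
  then show ?thesis using that[of "max A 1"] by simp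
qed

text \<open>The partial derivatives are continuous and periodic, hence bounded, and their bounds add
  up to a bound on the operator norm of the derivative.\<close>

lemma Ck_lattice_periodic_lipschitz:
  fixes F :: "real^'d \<Rightarrow> real"
  assumes F: "Ck (Suc m) F" and per: "lattice_periodic F"
  obtains L where "L > 0" "\<And>x y. \<bar>F x - F y\<bar> \<le> L * norm (x - y)"
proof -
  have "\<exists>A. \<forall>x. \<bar>frechet_derivative F (at x) (axis i 1)\<bar> \<le> A" for i
    using lattice_periodic_bounded[OF lattice_periodic_frechet_derivative[OF Ck_deriv(1)[OF F] per]
        Ck_continuous_on[OF Ck_deriv(2)[OF F]]] by metis
  then obtain A where A: "\<And>i x. \<bar>frechet_derivative F (at x) (axis i 1)\<bar> \<le> A i" by metis
  define L where "L = (\<Sum>i\<in>UNIV. A i)"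
  have "onorm (frechet_derivative F (at x)) \<le> L" for x
  proof (rule onorm_le)
    fix h :: "real^'d"
    have lin: "linear (frechet_derivative F (at x))" using Ck_deriv(1)[OF F] by (rule has_derivative_linear)
    have "frechet_derivative F (at x) h = frechet_derivative F (at x) (\<Sum>i\<in>UNIV. (h $ i) *\<^sub>R axis i 1)"
      by (simp add: basis_expansion flip: scalar_mult_eq_scaleR)
    also have "\<dots> = (\<Sum>i\<in>UNIV. h $ i * frechet_derivative F (at x) (axis i 1))"
      by (simp add: linear_sum[OF lin] linear_scale[OF lin])
    also have "\<bar>\<dots>\<bar> \<le> (\<Sum>i\<in>UNIV. norm h * A i)"
      by (rule order.trans[OF sum_abs]) (auto intro!: sum_mono mult_mono A component_le_norm_cart simp: abs_mult)
    finally show "norm (frechet_derivative F (at x) h) \<le> L * norm h"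
      by (simp add: L_def sum_distrib_left sum_distrib_right mult.commute)
  qed
  then have "norm (F x - F y) \<le> L * norm (x - y)" for x y
    by (intro differentiable_bound[where S=UNIV and f'="\<lambda>x. frechet_derivative F (at x)"]
        has_derivative_at_withinI[OF Ck_deriv(1)[OF F]]) auto
  then have "\<bar>F x - F y\<bar> \<le> max L 1 * norm (x - y)" for x y
    by (metis max.cobounded1 mult_right_mono norm_ge_zero order.trans real_norm_def)
  then show ?thesis using that[of "max L 1"] by simp
qed

section \<open>Iterated forward differences\<close>

definition fwd_diff :: "'a::plus \<Rightarrow> ('a \<Rightarrow> real) \<Rightarrow> 'a \<Rightarrow> real" where
  "fwd_diff v F y = F (y + v) - F y"

lemma fwd_diff_funpow_has_real_derivative:
  fixes F :: "'a::real_vector \<Rightarrow> real"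
  assumes "\<And>y t. ((\<lambda>t. F (y + t *\<^sub>R e)) has_real_derivative F' (y + t *\<^sub>R e)) (at t)"
  shows "((\<lambda>t. (fwd_diff v ^^ m) F (y + t *\<^sub>R e)) has_real_derivative (fwd_diff v ^^ m) F' (y + t *\<^sub>R e)) (at t)"
proof (induction m arbitrary: y t)
  case (Suc m)
  show ?case
    using DERIV_diff[OF Suc[of "y + v" t] Suc[of y t]] by (simp add: fwd_diff_def algebra_simps)
qed (use assms in simp)

text \<open>Differences commute with the derivative along \<open>axis i 1\<close>, and the mean
  value inequality turns the outermost difference into one derivative and one factor
  \<open>h\<close>. Periodicity bounds the last derivative on the whole space, so the constant is
  the same for every \<open>h\<close>; this is what makes the later decay uniform in the
  grid.\<close>

lemma Ck_fwd_diff_bound: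
  fixes F :: "real^'d \<Rightarrow> real"
  assumes "Ck m F" "lattice_periodic F"
  shows "\<exists>A. \<forall>h\<ge>0. \<forall>y. \<bar>(fwd_diff (h *\<^sub>R axis i 1) ^^ m) F y\<bar> \<le> A * h ^ m"
  using assms
proof (induction m arbitrary: F)
  case 0
  then show ?case using lattice_periodic_bounded[of F] by (metis Ck.simps(1) funpow_0 mult_1_right power_0)
next
  case (Suc m)
  define F' where "F' x = frechet_derivative F (at x) (axis i 1)" for x
  have d: "((\<lambda>t. F (y + t *\<^sub>R axis i 1)) has_real_derivative F' (y + t *\<^sub>R axis i 1)) (at t)" for y t
  proof -
    let ?D = "frechet_derivative F (at (y + t *\<^sub>R axis i 1))"
    have D: "(F has_derivative ?D) (at (y + t *\<^sub>R axis i 1))" using Ck_deriv(1)[OF Suc.prems(1)] .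
    have "((\<lambda>t. y + t *\<^sub>R axis i 1) has_derivative (\<lambda>s. s *\<^sub>R axis i (1::real))) (at t)"
      by (auto intro!: derivative_eq_intros)
    from diff_chain_at[OF this D] show ?thesis
      unfolding has_field_derivative_def o_def F'_def
      by (rule has_derivative_eq_rhs) (simp add: linear_scale[OF has_derivative_linear[OF D]] fun_eq_iff)
  qed
  have "Ck m F'" "lattice_periodic F'"
    unfolding F'_def
    by (rule Ck_deriv(2)[OF Suc.prems(1)],
        rule lattice_periodic_frechet_derivative[OF Ck_deriv(1)[OF Suc.prems(1)] Suc.prems(2)])
  from Suc.IH[OF this] obtain A where
    A: "\<And>h y. h \<ge> 0 \<Longrightarrow> \<bar>(fwd_diff (h *\<^sub>R axis i 1) ^^ m) F' y\<bar> \<le> A * h ^ m" by blast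
  have "\<bar>(fwd_diff (h *\<^sub>R axis i 1) ^^ Suc m) F y\<bar> \<le> A * h ^ Suc m" if h: "h \<ge> 0" for h y
  proof -
    let ?D = "fwd_diff (h *\<^sub>R axis i (1::real)) ^^ m"
    have "norm (?D F (y + h *\<^sub>R axis i 1) - ?D F (y + 0 *\<^sub>R axis i 1)) \<le> (A * h ^ m) * norm (h - 0)"
      by (rule field_differentiable_bound[where S=UNIV
            and f="\<lambda>t. ?D F (y + t *\<^sub>R axis i 1)" and f'="\<lambda>t. ?D F' (y + t *\<^sub>R axis i 1)"])
        (auto intro!: fwd_diff_funpow_has_real_derivative d A h)
    then show ?thesis using h by (simp add: fwd_diff_def mult_ac)
  qed
  then show ?case by blast
qed

section \<open>Grids, characters and trigonometric interpolation\<close>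

definition freq :: "('d::finite \<Rightarrow> int) \<Rightarrow> real^'d" where
  "freq k = (\<chi> i. of_int (k i))"

text \<open>Frequencies are integer-valued functions rather than vectors, so that a box is a
  \<open>PiE\<close> and sums of products over it factor by \<open>prod_sum_PiE\<close>.\<close>

definition freq_box :: "nat \<Rightarrow> ('d::finite \<Rightarrow> int) set" where
  "freq_box M = PiE UNIV (\<lambda>_. {- int M..int M})"

lemma freq_component [simp]: "freq k $ i = of_int (k i)"
  by (simp add: freq_def)

lemma freq_int_vec: "freq k \<in> int_vec"
  by (simp add: int_vec_def)

lemma mem_freq_box: "k \<in> freq_box M \<longleftrightarrow> (\<forall>i. \<bar>k i\<bar> \<le> int M)"
  by (auto simp: freq_box_def PiE_iff abs_le_iff minus_le_iff)

lemma finite_freq_box [simp]: "finite (freq_box M)"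
  unfolding freq_box_def by (intro finite_PiE) auto

lemma cis_sum: "finite I \<Longrightarrow> cis (\<Sum>i\<in>I. f i) = (\<Prod>i\<in>I. cis (f i))"
  by (induction I rule: finite_induct) (auto simp flip: cis_mult)

lemma cis_2pi_int: "cis (2 * pi * of_int n) = 1"
  by (simp add: cis_multiple_2pi)

lemma cis_2pi_eq_1_imp_int:
  assumes "cis (2 * pi * x) = 1"
  shows "x \<in> \<int>"
proof -
  have "cos (2 * pi * x) = 1" using assms by (simp add: complex_eq_iff)
  then obtain n where "2 * pi * x = of_int n * 2 * pi" using cos_one_2pi_int by blast
  then show ?thesis by simp
qed

text \<open>The odd number makes the range from -M to M a complete set of residues and keeps every
  frequency below half the grid size, where the chord bound for roots of unity applies.\<close>

definition grid_size :: "nat \<Rightarrow> nat" where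
  "grid_size M = 2 * M + 1"

lemma grid_size_pos [simp]: "grid_size M > 0" "grid_size M \<noteq> 0"
  by (simp_all add: grid_size_def)

lemma int_grid_size: "int (grid_size M) = 2 * int M + 1"
  by (simp add: grid_size_def)

lemma sum_int_symmetric_interval:
  "(\<Sum>a\<in>{- int M..int M}. f a) = (\<Sum>n<grid_size M. f (int n - int M))"
  by (rule sum.reindex_bij_witness[where i="\<lambda>n. int n - int M" and j="\<lambda>a. nat (a + int M)"])
    (auto simp: grid_size_def)

text \<open>A full geometric sum of powers of an N-th root of unity vanishes unless the root is 1;
  as |p| \<le> 2M < N, that happens only for p = 0.\<close>

lemma sum_cis_symmetric_interval:
  assumes p: "\<bar>p\<bar> \<le> 2 * int M"
  shows "(\<Sum>a\<in>{- int M..int M}. cis (2 * pi * (of_int a * of_int p / real (grid_size M))))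
    = (if p = 0 then of_nat (grid_size M) else 0)"
proof (cases "p = 0")
  case False
  let ?N = "real (grid_size M)"
  define z where "z = cis (2 * pi * (of_int p / ?N))"
  have "z \<noteq> 1"
  proof
    assume "z = 1"
    then have "of_int p / ?N \<in> \<int>" unfolding z_def by (rule cis_2pi_eq_1_imp_int)
    then obtain q where "of_int p / ?N = of_int q" by (auto elim: Ints_cases)
    then have "of_int p = of_int q * ?N" by (simp add: field_simps)
    also have "\<dots> = of_int (q * int (grid_size M))" by simp
    finally have q: "p = q * int (grid_size M)" by (simp only: of_int_eq_iff)
    with False have "q \<noteq> 0" by auto
    then have "1 * int (grid_size M) \<le> \<bar>q\<bar> * int (grid_size M)" by (intro mult_right_mono) auto
    also have "\<dots> = \<bar>p\<bar>" unfolding q by (simp add: abs_mult)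
    finally show False using p by (simp add: int_grid_size)
  qed
  have zN: "z ^ grid_size M = 1"
  proof -
    have "real (grid_size M) * (2 * pi * (of_int p / ?N)) = 2 * pi * of_int p" by simp
    then show ?thesis unfolding z_def Complex.DeMoivre by (simp only: cis_2pi_int)
  qed
  have "(\<Sum>a\<in>{- int M..int M}. cis (2 * pi * (of_int a * of_int p / ?N)))
      = (\<Sum>n<grid_size M. cis (- (2 * pi * (real M * of_int p / ?N))) * z ^ n)"
    unfolding sum_int_symmetric_interval z_def Complex.DeMoivre cis_mult
    by (intro sum.cong refl arg_cong[where f=cis]) (simp add: field_simps)
  also have "\<dots> = cis (- (2 * pi * (real M * of_int p / ?N))) * (\<Sum>n<grid_size M. z ^ n)"
    by (simp only: sum_distrib_left)
  also have "(\<Sum>n<grid_size M. z ^ n) = 0"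
    using geometric_sum[OF \<open>z \<noteq> 1\<close>, of "grid_size M"] zN by simp
  finally show ?thesis using False by simp
qed (simp add: grid_size_def)

text \<open>The character of an inner product is a product of one-dimensional characters, so the sum
  factors over the coordinates; the difference of two indices in the box stays within 2M in each of
  them.\<close>

lemma sum_cis_freq_box:
  fixes l j :: "'d::finite \<Rightarrow> int"
  assumes "l \<in> freq_box M" "j \<in> freq_box M"
  shows "(\<Sum>k\<in>freq_box M. cis (2 * pi * (freq k \<bullet> (freq l - freq j) / real (grid_size M))))
    = (if l = j then of_nat (grid_size M) ^ CARD('d) else 0)"
proof -
  let ?N = "real (grid_size M)"
  have bound: "\<bar>l i - j i\<bar> \<le> 2 * int M" for i
  proof -
    have "\<bar>l i\<bar> \<le> int M" "\<bar>j i\<bar> \<le> int M" using assms by (auto simp: mem_freq_box)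
    then show ?thesis by linarith
  qed
  have "(\<Sum>k\<in>freq_box M. cis (2 * pi * (freq k \<bullet> (freq l - freq j) / ?N)))
      = (\<Sum>k\<in>freq_box M. \<Prod>i\<in>UNIV. cis (2 * pi * (of_int (k i) * of_int (l i - j i) / ?N)))"
    by (intro sum.cong refl)
      (simp add: inner_vec_def sum_distrib_left sum_divide_distrib flip: cis_sum)
  also have "\<dots> = (\<Prod>i\<in>UNIV. \<Sum>a\<in>{- int M..int M}. cis (2 * pi * (of_int a * of_int (l i - j i) / ?N)))"
    unfolding freq_box_def by (subst prod_sum_PiE) auto
  also have "\<dots> = (\<Prod>i\<in>UNIV. if l i - j i = 0 then of_nat (grid_size M) else 0)"
    by (intro prod.cong refl sum_cis_symmetric_interval bound)
  also have "\<dots> = (if l = j then of_nat (grid_size M) ^ CARD('d) else 0)"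
    by (auto simp: fun_eq_iff)
  finally show ?thesis .
qed

text \<open>\<open>freq_box M\<close> indexes both the frequencies and the points of the grid.\<close>

definition dft :: "nat \<Rightarrow> (real^'d \<Rightarrow> real) \<Rightarrow> ('d \<Rightarrow> int) \<Rightarrow> complex" where
  "dft M H k = (\<Sum>j\<in>freq_box M. of_real (H ((1 / real (grid_size M)) *\<^sub>R freq j))
      * cis (- (2 * pi * (freq k \<bullet> freq j / real (grid_size M))))) / of_nat (grid_size M) ^ CARD('d)"

definition trig_interp :: "nat \<Rightarrow> (real^'d \<Rightarrow> real) \<Rightarrow> real^'d \<Rightarrow> complex" where
  "trig_interp M H y = (\<Sum>k\<in>freq_box M. dft M H k * cis (2 * pi * (freq k \<bullet> y)))"

lemma trig_interp_grid_box:
  fixes H :: "real^'d \<Rightarrow> real"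
  assumes "l \<in> freq_box M"
  shows "trig_interp M H ((1 / real (grid_size M)) *\<^sub>R freq l) = of_real (H ((1 / real (grid_size M)) *\<^sub>R freq l))"
proof -
  let ?N = "real (grid_size M)" and ?Nd = "of_nat (grid_size M) ^ CARD('d) :: complex"
  let ?H = "\<lambda>j. of_real (H ((1 / ?N) *\<^sub>R freq j)) :: complex"
  have phase: "cis (- (2 * pi * (freq k \<bullet> freq j / ?N))) * cis (2 * pi * (freq k \<bullet> ((1 / ?N) *\<^sub>R freq l)))
      = cis (2 * pi * (freq k \<bullet> (freq l - freq j) / ?N))" for k j :: "'d \<Rightarrow> int"
    unfolding cis_mult by (rule arg_cong[where f=cis]) (simp add: inner_diff_right field_simps)
  have "trig_interp M H ((1 / ?N) *\<^sub>R freq l)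
      = (\<Sum>k\<in>freq_box M. \<Sum>j\<in>freq_box M. ?H j / ?Nd * cis (2 * pi * (freq k \<bullet> (freq l - freq j) / ?N)))"
    unfolding trig_interp_def dft_def sum_divide_distrib sum_distrib_right phase[symmetric]
    by (intro sum.cong refl) simp
  also have "\<dots> = (\<Sum>j\<in>freq_box M. ?H j / ?Nd * (\<Sum>k\<in>freq_box M. cis (2 * pi * (freq k \<bullet> (freq l - freq j) / ?N))))"
    by (subst sum.swap) (simp only: sum_distrib_left)
  also have "\<dots> = (\<Sum>j\<in>freq_box M. if l = j then ?H j else 0)"
    by (intro sum.cong refl, subst sum_cis_freq_box[OF assms]) auto
  also have "\<dots> = ?H l" using assms by simp
  finally show ?thesis .
qed

lemma trig_interp_grid:
  fixes H :: "real^'d \<Rightarrow> real"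
  assumes per: "lattice_periodic H"
  shows "trig_interp M H ((1 / real (grid_size M)) *\<^sub>R freq l) = of_real (H ((1 / real (grid_size M)) *\<^sub>R freq l))"
proof -
  let ?N = "2 * int M + 1"
  \<comment> \<open>Adding M before the reduction and subtracting it afterwards selects the residue
    of \<open>l i\<close> in the symmetric range.\<close>
  define j where "j i = (l i + int M) mod ?N - int M" for i
  define q where "q i = (l i + int M) div ?N" for i
  have l: "l i = j i + q i * ?N" for i
    unfolding j_def q_def using div_mult_mod_eq[of "l i + int M" ?N] by linarith
  have "j \<in> freq_box M"
    unfolding mem_freq_box
  proof
    fix i
    have "0 \<le> (l i + int M) mod ?N" "(l i + int M) mod ?N < ?N"
      by (rule pos_mod_sign pos_mod_bound; simp)+
    then show "\<bar>j i\<bar> \<le> int M" unfolding j_def by linarith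
  qed
  moreover have y: "(1 / real (grid_size M)) *\<^sub>R freq l = (1 / real (grid_size M)) *\<^sub>R freq j + freq q"
    by (simp add: vec_eq_iff l grid_size_def field_simps)
  moreover have "trig_interp M H (x + freq q) = trig_interp M H x" for x
  proof -
    have "cis (2 * pi * (freq k \<bullet> (x + freq q))) = cis (2 * pi * (freq k \<bullet> x))" for k
    proof -
      have "freq k \<bullet> freq q = of_int (\<Sum>i\<in>UNIV. k i * q i)" by (simp add: inner_vec_def)
      then show ?thesis
        using cis_2pi_int[of "\<Sum>i\<in>UNIV. k i * q i"] by (simp add: inner_add_right distrib_left flip: cis_mult)
    qed
    then show ?thesis by (simp add: trig_interp_def)
  qed
  moreover have "H (x + freq q) = H x" for x
    using per freq_int_vec[of q] by (auto simp: lattice_periodic_def)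
  ultimately show ?thesis using trig_interp_grid_box[of j M H] by simp
qed

text \<open>One step along the grid permutes the residues cyclically: the index M wraps round to -M,
  and the periodicity of \<open>g\<close> hides the jump.\<close>

lemma sum_freq_box_shift:
  fixes g :: "('d::finite \<Rightarrow> int) \<Rightarrow> 'b::comm_monoid_add"
  assumes per: "\<And>j. g (j(i := j i + (2 * int M + 1))) = g j"
  shows "(\<Sum>j\<in>freq_box M. g (j(i := j i + 1))) = (\<Sum>j\<in>freq_box M. g j)"
proof (rule sum.reindex_bij_witness[where
      j="\<lambda>j. j(i := if j i = int M then - int M else j i + 1)" and
      i="\<lambda>j. j(i := if j i = - int M then int M else j i - 1)"])
  fix j :: "'d \<Rightarrow> int" assume j: "j \<in> freq_box M"
  show "g (j(i := if j i = int M then - int M else j i + 1)) = g (j(i := j i + 1))"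
    using per[of "j(i := - int M)"] by auto
next
  fix j :: "'d \<Rightarrow> int" assume j: "j \<in> freq_box M"
  then have b: "\<bar>j i'\<bar> \<le> int M" for i' by (simp add: mem_freq_box)
  show "j(i := if j i = int M then - int M else j i + 1) \<in> freq_box M"
    "j(i := if j i = - int M then int M else j i - 1) \<in> freq_box M"
    unfolding mem_freq_box by (intro allI; use b in \<open>smt (verit, best) fun_upd_apply\<close>)+
qed (auto simp: fun_eq_iff mem_freq_box abs_le_iff dest: spec[of _ i])

text \<open>Moving the shift from the function to the summation index multiplies every phase by the
  same root of unity. Hence differences act on the coefficients as multipliers.\<close>

lemma dft_shift:
  assumes per: "lattice_periodic H"
  shows "dft M (\<lambda>y. H (y + (1 / real (grid_size M)) *\<^sub>R axis i 1)) k
    = cis (2 * pi * (of_int (k i) / real (grid_size M))) * dft M H k"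
proof -
  let ?N = "real (grid_size M)"
  define g where "g j = of_real (H ((1 / ?N) *\<^sub>R freq j)) * cis (- (2 * pi * (freq k \<bullet> freq j / ?N)))" for j
  have upd: "freq (j(i := j i + a)) = freq j + of_int a *\<^sub>R axis i 1" for j :: "'a \<Rightarrow> int" and a
    by (simp add: vec_eq_iff axis_def)
  have g_per: "g (j(i := j i + (2 * int M + 1))) = g j" for j
  proof -
    have "(1 / ?N) *\<^sub>R (?N *\<^sub>R axis i 1) = (axis i 1 :: real^'a)" by simp
    moreover have "(axis i 1 :: real^'a) \<in> int_vec" by (simp add: int_vec_def axis_def)
    ultimately have "H ((1 / ?N) *\<^sub>R (freq j + ?N *\<^sub>R axis i 1)) = H ((1 / ?N) *\<^sub>R freq j)"
      using per by (simp add: lattice_periodic_def scaleR_add_right)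
    moreover have "cis (- (2 * pi * (freq k \<bullet> (freq j + ?N *\<^sub>R axis i 1) / ?N)))
        = cis (- (2 * pi * (freq k \<bullet> freq j / ?N))) * cis (2 * pi * of_int (- k i))"
      unfolding cis_mult by (rule arg_cong[where f=cis]) (simp add: inner_add_right inner_axis field_simps)
    ultimately show ?thesis
      unfolding g_def upd cis_2pi_int by (simp flip: int_grid_size)
  qed
  have shift: "of_real (H ((1 / ?N) *\<^sub>R freq j + (1 / ?N) *\<^sub>R axis i 1)) * cis (- (2 * pi * (freq k \<bullet> freq j / ?N)))
      = cis (2 * pi * (of_int (k i) / ?N)) * g (j(i := j i + 1))" for j
  proof -
    have "cis (- (2 * pi * (freq k \<bullet> freq j / ?N)))
        = cis (2 * pi * (of_int (k i) / ?N)) * cis (- (2 * pi * (freq k \<bullet> (freq j + of_int 1 *\<^sub>R axis i 1) / ?N)))"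
      unfolding cis_mult by (rule arg_cong[where f=cis]) (simp add: inner_add_right inner_axis field_simps)
    then show ?thesis
      unfolding g_def upd by (simp add: scaleR_add_right)
  qed
  show ?thesis
    unfolding dft_def shift sum_distrib_left[symmetric] sum_freq_box_shift[of g, OF g_per]
    by (simp add: g_def)
qed

section \<open>Decay of the discrete coefficients\<close>

lemma lattice_periodic_fwd_diff: "lattice_periodic H \<Longrightarrow> lattice_periodic (fwd_diff v H)"
  unfolding lattice_periodic_def fwd_diff_def
  by (metis (no_types, lifting) add.assoc add.commute)

lemma dft_fwd_diff:
  assumes "lattice_periodic H"
  shows "dft M (fwd_diff ((1 / real (grid_size M)) *\<^sub>R axis i 1) H) k
    = (cis (2 * pi * (of_int (k i) / real (grid_size M))) - 1) * dft M H k"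
proof -
  have "dft M (fwd_diff ((1 / real (grid_size M)) *\<^sub>R axis i 1) H) k
      = dft M (\<lambda>y. H (y + (1 / real (grid_size M)) *\<^sub>R axis i 1)) k - dft M H k"
    by (simp add: dft_def fwd_diff_def left_diff_distrib sum_subtractf diff_divide_distrib)
  then show ?thesis unfolding dft_shift[OF assms] by (simp add: algebra_simps)
qed

lemma dft_fwd_diff_funpow:
  assumes "lattice_periodic H"
  shows "dft M ((fwd_diff ((1 / real (grid_size M)) *\<^sub>R axis i 1) ^^ m) H) k
    = (cis (2 * pi * (of_int (k i) / real (grid_size M))) - 1) ^ m * dft M H k"
proof (induction m)
  case (Suc m)
  have "lattice_periodic ((fwd_diff ((1 / real (grid_size M)) *\<^sub>R axis i 1) ^^ m) H)"
    by (induction m) (use assms lattice_periodic_fwd_diff in auto)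
  then show ?case by (simp add: dft_fwd_diff Suc)
qed simp

lemma card_freq_box: "card (freq_box M :: ('d::finite \<Rightarrow> int) set) = grid_size M ^ CARD('d)"
proof -
  have "card {- int M..int M} = grid_size M" by (simp add: grid_size_def)
  then show ?thesis unfolding freq_box_def by (simp add: card_PiE del: card_atLeastAtMost_int)
qed

lemma norm_dft_le:
  fixes H :: "real^'d \<Rightarrow> real"
  assumes "\<And>y. \<bar>H y\<bar> \<le> B"
  shows "norm (dft M H k) \<le> B"
proof -
  let ?Nd = "real (grid_size M) ^ CARD('d)"
  have "norm (dft M H k) \<le> (\<Sum>j\<in>(freq_box M :: ('d \<Rightarrow> int) set). B) / ?Nd"
    unfolding dft_def norm_divide norm_power norm_of_nat
    by (intro divide_right_mono sum_norm_le) (auto simp: norm_mult assms)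
  also have "\<dots> = B" by (simp add: card_freq_box)
  finally show ?thesis .
qed

text \<open>The weak slope 1/(2 pi) suffices: at pi |p| / N, doubled for the chord length, it yields
  exactly |p| / N. Up to pi/3 the cosine is at least 1/2; beyond that the sine is at least 1/2 while
  the left side is at most 1/4.\<close>

lemma sin_ge_linear:
  assumes "0 \<le> x" "x \<le> pi / 2"
  shows "x / (2 * pi) \<le> sin x"
proof (cases "x \<le> pi / 3")
  case True
  have "norm (x - 0) * (1/2) \<le> sin x"
  proof (cases "x = 0")
    case False
    then have "0 < x" using assms by simp
    then obtain z where z: "0 < z" "z < x" "sin x - sin 0 = (x - 0) * cos z"
      using MVT2[of 0 x sin cos] by auto
    have "cos z \<ge> cos (pi / 3)" using z True assms by (intro cos_monotone_0_pi_le) auto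
    then show ?thesis using z mult_left_mono[of "1/2" "cos z" x] \<open>0 < x\<close> by (simp add: cos_60)
  qed simp
  moreover have "x / (2 * pi) \<le> x / 2"
    using assms pi_gt3 by (intro divide_left_mono) auto
  ultimately show ?thesis using assms by simp
next
  case False
  have "sin (pi / 6) \<le> sin x" using False assms by (intro sin_monotone_2pi_le) auto
  then have "1 / 2 \<le> sin x" by (simp add: sin_30)
  moreover have "x / (2 * pi) \<le> 1 / 4" using assms pi_gt_zero by (simp add: field_simps)
  ultimately show ?thesis by linarith
qed

lemma norm_cis_minus_1: "norm (cis t - 1) = 2 * \<bar>sin (t / 2)\<bar>"
  by (metis cis_conv_exp dist_exp_i_1)

lemma norm_cis_grid_ge:
  assumes "\<bar>p\<bar> \<le> int M"
  shows "of_int \<bar>p\<bar> / real (grid_size M) \<le> norm (cis (2 * pi * (of_int p / real (grid_size M))) - 1)"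
proof -
  let ?x = "pi * (of_int \<bar>p\<bar> / real (grid_size M))"
  have "of_int \<bar>p\<bar> \<le> real M" using assms by linarith
  then have "of_int \<bar>p\<bar> / real (grid_size M) \<le> 1 / 2" by (simp add: grid_size_def field_simps)
  then have "?x \<le> pi * (1/2)" by (intro mult_left_mono) auto
  then have "?x / (2 * pi) \<le> sin ?x" by (intro sin_ge_linear) auto
  moreover have "\<bar>sin (pi * (of_int p / real (grid_size M)))\<bar> = \<bar>sin ?x\<bar>"
    by (cases "p \<ge> 0") (auto simp: abs_if)
  ultimately show ?thesis unfolding norm_cis_minus_1 by simp
qed

lemma maxnorm_attained:
  obtains i where "maxnorm x = \<bar>x $ i\<bar>"
proof -
  have "maxnorm x \<in> range (\<lambda>i. \<bar>x $ i\<bar>)" unfolding maxnorm_def by (rule Max_in) auto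
  then show ?thesis using that by blast
qed

lemma maxnorm_freq_ge_1:
  assumes "k \<noteq> (\<lambda>_. 0)"
  shows "maxnorm (freq k) \<ge> 1"
proof -
  obtain i where "k i \<noteq> 0" using assms by auto
  then have "1 \<le> \<bar>freq k $ i\<bar>" by simp
  also have "\<dots> \<le> maxnorm (freq k)" by (rule maxnorm_ge)
  finally show ?thesis .
qed

text \<open>The differences are taken in the direction of the largest coordinate of
  \<open>k\<close>, where the multiplier is at least \<open>maxnorm (freq k)\<close> divided by the
  grid size N. The m-th difference with step 1/N is at most a constant times 1/N^m, so the powers of
  N cancel.\<close>

lemma dft_decay:
  fixes H :: "real^'d \<Rightarrow> real"
  assumes Ck: "Ck m H" and per: "lattice_periodic H"
  obtains A where "A > 0" "\<And>M k. k \<in> freq_box M \<Longrightarrow> k \<noteq> (\<lambda>_. 0) \<Longrightarrow>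
    norm (dft M H k) \<le> A * maxnorm (freq k) powr (- real m)"
proof -
  obtain A where A: "\<And>i h y. h \<ge> 0 \<Longrightarrow> \<bar>(fwd_diff (h *\<^sub>R axis i 1) ^^ m) H y\<bar> \<le> A i * h ^ m"
    using Ck_fwd_diff_bound[OF assms] by metis
  define A' where "A' = max 1 (Max (range A))"
  have A': "A i \<le> A'" for i unfolding A'_def by (intro max.coboundedI2 Max_ge) auto
  have "norm (dft M H k) \<le> A' * maxnorm (freq k) powr (- real m)"
    if k: "k \<in> freq_box M" "k \<noteq> (\<lambda>_. 0)" for M k
  proof -
    let ?N = "real (grid_size M)"
    obtain i where i: "maxnorm (freq k) = \<bar>freq k $ i\<bar>" using maxnorm_attained .
    let ?K = "maxnorm (freq k)" and ?z = "cis (2 * pi * (of_int (k i) / ?N)) - 1"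
    have K: "?K \<ge> 1" by (rule maxnorm_freq_ge_1[OF k(2)])
    have "?K / ?N \<le> norm ?z"
      using norm_cis_grid_ge[of "k i" M] k(1) unfolding i by (simp add: mem_freq_box)
    then have "(?K / ?N) ^ m * norm (dft M H k) \<le> norm ?z ^ m * norm (dft M H k)"
      using K by (intro mult_right_mono power_mono) auto
    also have "\<dots> = norm (dft M ((fwd_diff ((1 / ?N) *\<^sub>R axis i 1) ^^ m) H) k)"
      by (simp only: dft_fwd_diff_funpow[OF per] norm_mult norm_power)
    also have "\<dots> \<le> A i * (1 / ?N) ^ m"
      by (intro norm_dft_le A) simp
    also have "\<dots> \<le> A' * (1 / ?N) ^ m" by (intro mult_right_mono A') simp
    finally have "?K ^ m * norm (dft M H k) \<le> A'"
      by (simp add: power_divide field_simps)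
    then show ?thesis
      using K by (simp add: powr_minus powr_realpow field_simps)
  qed
  then show ?thesis using that[of A'] by (simp add: A'_def)
qed

lemma sum_int_abs_powr_bounded:
  assumes q: "q > 1"
  obtains Z where "Z \<ge> 0" "\<And>M. (\<Sum>a\<in>{- int M..int M}. max 1 \<bar>of_int a\<bar> powr (- q)) \<le> (Z::real)"
proof -
  define S where "S = (\<Sum>n. real n powr (- q))"
  have summable: "summable (\<lambda>n. real n powr (- q))" using q by (simp add: summable_real_powr_iff)
  \<comment> \<open>The leading 1 is the term \<open>a = 0\<close>; on the right the term
    \<open>n = 0\<close> vanishes because \<open>0 powr (- q)\<close> is 0.\<close>
  have eq: "(\<Sum>a\<in>{- int M..int M}. max 1 \<bar>of_int a\<bar> powr (- q)) = 1 + 2 * (\<Sum>n<Suc M. real n powr (- q))" for M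
  proof (induction M)
    case (Suc M)
    have "{- int (Suc M)..int (Suc M)} = insert (int (Suc M)) (insert (- int (Suc M)) {- int M..int M})"
      by auto
    then show ?case using Suc by (simp add: add_ac)
  qed simp
  have "(\<Sum>n<Suc M. real n powr (- q)) \<le> S" for M
    unfolding S_def by (intro sum_le_suminf summable) auto
  then have "1 + 2 * (\<Sum>n<Suc M. real n powr (- q)) \<le> 1 + 2 * S" for M by (meson add_left_mono mult_left_mono zero_le_numeral)
  moreover have "S \<ge> 0" unfolding S_def by (intro suminf_nonneg summable) auto
  ultimately show ?thesis by (intro that[of "1 + 2 * S"]) (auto simp only: eq)
qed

text \<open>Since \<open>max 1 \<bar>k i\<bar> \<le> maxnorm (freq k)\<close> for every \<open>i\<close>, the lattice sum is dominated by a product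
  of one-dimensional sums with exponent \<open>p / CARD('d)\<close>.\<close>

lemma lattice_sum_powr_bounded:
  assumes p: "p > real CARD('d::finite)"
  obtains Z where "Z \<ge> 0" "\<And>M. (\<Sum>k\<in>freq_box M - {\<lambda>_. 0}. maxnorm (freq (k :: 'd \<Rightarrow> int)) powr (- p)) \<le> Z"
proof -
  define q where "q = p / real CARD('d)"
  have q: "q > 1" using p unfolding q_def by simp
  obtain Z where Z: "Z \<ge> 0" "\<And>M. (\<Sum>a\<in>{- int M..int M}. max 1 \<bar>of_int a\<bar> powr (- q)) \<le> Z"
    using sum_int_abs_powr_bounded[OF q] by blast
  have "(\<Sum>k\<in>freq_box M - {\<lambda>_. 0}. maxnorm (freq (k :: 'd \<Rightarrow> int)) powr (- p)) \<le> Z ^ CARD('d)" for M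
  proof -
    have dominated: "maxnorm (freq k) powr (- p) \<le> (\<Prod>i\<in>UNIV. max 1 \<bar>of_int (k i)\<bar> powr (- q))"
      if "k \<noteq> (\<lambda>_. 0)" for k :: "'d \<Rightarrow> int"
    proof -
      have K: "maxnorm (freq k) \<ge> 1" by (rule maxnorm_freq_ge_1[OF that])
      have "maxnorm (freq k) powr (- p) = (\<Prod>i\<in>(UNIV :: 'd set). maxnorm (freq k) powr (- q))"
        using K by (simp add: q_def powr_powr flip: powr_realpow)
      also have "\<dots> \<le> (\<Prod>i\<in>UNIV. max 1 \<bar>of_int (k i)\<bar> powr (- q))"
      proof (intro prod_mono conjI powr_mono2')
        show "max 1 \<bar>of_int (k i)\<bar> \<le> maxnorm (freq k)" for i
          using K maxnorm_ge[of "freq k" i] by simp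
      qed (use q in auto)
      finally show ?thesis .
    qed
    have "(\<Sum>k\<in>freq_box M - {\<lambda>_. 0}. maxnorm (freq (k :: 'd \<Rightarrow> int)) powr (- p))
        \<le> (\<Sum>k\<in>freq_box M - {\<lambda>_. 0}. \<Prod>i\<in>(UNIV::'d set). max 1 \<bar>of_int (k i)\<bar> powr (- q))"
      by (intro sum_mono dominated) auto
    also have "\<dots> \<le> (\<Sum>k\<in>freq_box M. \<Prod>i\<in>(UNIV::'d set). max 1 \<bar>of_int (k i)\<bar> powr (- q))"
      by (intro sum_mono2) (auto intro!: prod_nonneg)
    also have "\<dots> = (\<Prod>i\<in>(UNIV::'d set). \<Sum>a\<in>{- int M..int M}. max 1 \<bar>of_int a\<bar> powr (- q))"
      unfolding freq_box_def by (subst prod_sum_PiE) auto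
    also have "\<dots> \<le> (\<Prod>i\<in>(UNIV::'d set). Z)"
      by (intro prod_mono conjI sum_nonneg Z) auto
    finally show ?thesis by simp
  qed
  then show ?thesis using that[of "Z ^ CARD('d)"] Z by simp
qed

section \<open>Quasi-periodic fields\<close>

text \<open>The Lipschitz bound handles small angles and the trivial bound 2 large ones. Fractional
  exponents matter because the coefficients are controlled only against the weight |k|^\<sigma>, and
  \<sigma> may be below 1.\<close>

lemma norm_cis_diff_holder:
  assumes s: "0 < s" "s \<le> 1"
  shows "norm (cis a - cis b) \<le> 2 * \<bar>a - b\<bar> powr s"
proof -
  have "cis a - cis b = cis b * (cis (a - b) - 1)" by (simp add: right_diff_distrib cis_mult)
  then have eq: "norm (cis a - cis b) = 2 * \<bar>sin ((a - b) / 2)\<bar>"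
    by (simp add: norm_mult norm_cis_minus_1)
  show ?thesis
  proof (cases "\<bar>a - b\<bar> \<le> 1")
    case True
    have "2 * \<bar>sin ((a - b) / 2)\<bar> \<le> \<bar>a - b\<bar>"
      using abs_sin_x_le_abs_x[of "(a - b) / 2"] by simp
    also have "\<dots> \<le> \<bar>a - b\<bar> powr s"
      using powr_mono'[of s 1 "\<bar>a - b\<bar>"] True s by (cases "a = b") auto
    also have "\<dots> \<le> 2 * \<bar>a - b\<bar> powr s" by simp
    finally show ?thesis unfolding eq .
  next
    case False
    then have "1 \<le> \<bar>a - b\<bar> powr s" using s by (intro ge_one_powr_ge_zero) auto
    then show ?thesis unfolding eq using abs_sin_le_one[of "(a - b) / 2"] by linarith
  qed
qed

text \<open>This one sum serves twice: it makes the interpolants equicontinuous, and it pays for the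
  small divisors in the primitive.\<close>

lemma dft_weighted_sum_bounded:
  fixes H :: "real^'d \<Rightarrow> real"
  assumes Ck: "Ck m H" and per: "lattice_periodic H" and m: "real m > real CARD('d) + \<sigma>"
  obtains S where "S \<ge> 0" "\<And>M. (\<Sum>k\<in>freq_box M - {\<lambda>_. 0}. norm (dft M H k) * maxnorm (freq k) powr \<sigma>) \<le> S"
proof -
  obtain A where A: "A > 0" "\<And>M k. k \<in> freq_box M \<Longrightarrow> k \<noteq> (\<lambda>_. 0) \<Longrightarrow>
      norm (dft M H k) \<le> A * maxnorm (freq k) powr (- real m)"
    using dft_decay[OF Ck per] by blast
  have p: "real m - \<sigma> > real CARD('d)" using m by simp
  obtain Z where Z: "Z \<ge> 0" "\<And>M. (\<Sum>k\<in>freq_box M - {\<lambda>_. 0}. maxnorm (freq (k :: 'd \<Rightarrow> int)) powr (- (real m - \<sigma>))) \<le> Z"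
    using lattice_sum_powr_bounded[OF p] by blast
  have "(\<Sum>k\<in>freq_box M - {\<lambda>_. 0}. norm (dft M H k) * maxnorm (freq k) powr \<sigma>) \<le> A * Z" for M
  proof -
    have "(\<Sum>k\<in>freq_box M - {\<lambda>_. 0}. norm (dft M H k) * maxnorm (freq k) powr \<sigma>)
        \<le> (\<Sum>k\<in>freq_box M - {\<lambda>_. 0}. A * maxnorm (freq (k :: 'd \<Rightarrow> int)) powr (- (real m - \<sigma>)))"
    proof (rule sum_mono)
      fix k :: "'d \<Rightarrow> int" assume "k \<in> freq_box M - {\<lambda>_. 0}"
      then have "norm (dft M H k) * maxnorm (freq k) powr \<sigma> \<le> A * maxnorm (freq k) powr (- real m) * maxnorm (freq k) powr \<sigma>"
        by (intro mult_right_mono A) auto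
      also have "\<dots> = A * maxnorm (freq k) powr (- (real m - \<sigma>))"
        by (simp add: mult.assoc flip: powr_add)
      finally show "norm (dft M H k) * maxnorm (freq k) powr \<sigma> \<le> A * maxnorm (freq k) powr (- (real m - \<sigma>))" .
    qed
    also have "\<dots> \<le> A * Z"
      unfolding sum_distrib_left[symmetric] using A by (intro mult_left_mono Z) auto
    finally show ?thesis .
  qed
  then show ?thesis using that[of "A * Z"] A Z by simp
qed

lemma freq_zero_mem_freq_box: "(\<lambda>_. 0) \<in> freq_box M"
  by (simp add: mem_freq_box)

text \<open>The zero frequency cancels in the difference, and for all others
  \<open>maxnorm (freq k) \<ge> 1\<close> lets the exponent \<open>s\<close> be raised to \<sigma>.
  The factor \<open>real CARD('d)\<close> comes from passing between the Euclidean and the maximum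
  norm.\<close>

lemma trig_interp_holder:
  fixes H :: "real^'d \<Rightarrow> real"
  assumes s: "0 < s" "s \<le> 1" "s \<le> \<sigma>"
    and S: "(\<Sum>k\<in>freq_box M - {\<lambda>_. 0}. norm (dft M H k) * maxnorm (freq k) powr \<sigma>) \<le> S"
  shows "norm (trig_interp M H y - trig_interp M H z)
    \<le> 2 * (2 * pi * real CARD('d) * norm (y - z)) powr s * S"
proof -
  let ?D = "2 * pi * real CARD('d) * norm (y - z)"
  have "norm (trig_interp M H y - trig_interp M H z)
      = norm (\<Sum>k\<in>freq_box M - {\<lambda>_. 0}. dft M H k * (cis (2 * pi * (freq k \<bullet> y)) - cis (2 * pi * (freq k \<bullet> z))))"
  proof -
    have "freq (\<lambda>_. 0) = (0 :: real^'d)" by (simp add: vec_eq_iff)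
    then show ?thesis
      unfolding trig_interp_def
      by (simp add: sum_diff1 freq_zero_mem_freq_box right_diff_distrib flip: sum_subtractf)
  qed
  also have "\<dots> \<le> (\<Sum>k\<in>freq_box M - {\<lambda>_. 0}. 2 * ?D powr s * (norm (dft M H k) * maxnorm (freq k) powr \<sigma>))"
  proof (rule sum_norm_le)
    fix k :: "'d \<Rightarrow> int" assume k: "k \<in> freq_box M - {\<lambda>_. 0}"
    then have K: "maxnorm (freq k) \<ge> 1" by (intro maxnorm_freq_ge_1) auto
    have "\<bar>freq k \<bullet> (y - z)\<bar> \<le> norm (freq k) * norm (y - z)" by (rule Cauchy_Schwarz_ineq2)
    also have "\<dots> \<le> (real CARD('d) * maxnorm (freq k)) * norm (y - z)"
      by (intro mult_right_mono norm_le_maxnorm) auto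
    finally have "2 * pi * \<bar>freq k \<bullet> (y - z)\<bar> \<le> 2 * pi * (real CARD('d) * maxnorm (freq k) * norm (y - z))"
      by (intro mult_left_mono) auto
    moreover have "\<bar>2 * pi * (freq k \<bullet> y) - 2 * pi * (freq k \<bullet> z)\<bar> = 2 * pi * \<bar>freq k \<bullet> (y - z)\<bar>"
      by (simp add: inner_diff_right abs_mult flip: right_diff_distrib)
    ultimately have angle: "\<bar>2 * pi * (freq k \<bullet> y) - 2 * pi * (freq k \<bullet> z)\<bar> \<le> ?D * maxnorm (freq k)"
      by (simp add: mult_ac)
    have "norm (cis (2 * pi * (freq k \<bullet> y)) - cis (2 * pi * (freq k \<bullet> z)))
        \<le> 2 * \<bar>2 * pi * (freq k \<bullet> y) - 2 * pi * (freq k \<bullet> z)\<bar> powr s"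
      by (rule norm_cis_diff_holder[OF s(1,2)])
    also have "\<dots> \<le> 2 * (?D * maxnorm (freq k)) powr s"
      by (intro mult_left_mono powr_mono2 angle) (use s in auto)
    also have "\<dots> = 2 * ?D powr s * maxnorm (freq k) powr s"
      using K by (simp add: powr_mult)
    also have "\<dots> \<le> 2 * ?D powr s * maxnorm (freq k) powr \<sigma>"
      by (intro mult_left_mono powr_mono s K) auto
    finally have "norm (dft M H k) * norm (cis (2 * pi * (freq k \<bullet> y)) - cis (2 * pi * (freq k \<bullet> z)))
        \<le> norm (dft M H k) * (2 * ?D powr s * maxnorm (freq k) powr \<sigma>)"
      by (rule mult_left_mono) simp
    then show "norm (dft M H k * (cis (2 * pi * (freq k \<bullet> y)) - cis (2 * pi * (freq k \<bullet> z))))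
        \<le> 2 * ?D powr s * (norm (dft M H k) * maxnorm (freq k) powr \<sigma>)"
      by (simp add: norm_mult mult_ac)
  qed
  also have "\<dots> \<le> 2 * ?D powr s * S"
    unfolding sum_distrib_left[symmetric] by (intro mult_left_mono S) auto
  finally show ?thesis .
qed

text \<open>The interpolants are uniformly Hoelder continuous, so they converge uniformly because they agree with
  \<open>H\<close> on finer and finer grids.\<close>

lemma trig_interp_uniform:
  fixes H :: "real^'d \<Rightarrow> real"
  assumes Ck: "Ck m H" and per: "lattice_periodic H" and \<sigma>: "\<sigma> > 0" and m: "real m > real CARD('d) + \<sigma>"
  obtains \<eta> where "\<eta> \<longlonglongrightarrow> 0" "\<And>M y. norm (trig_interp M H y - of_real (H y)) \<le> \<eta> M"
proof -
  obtain S where S: "S \<ge> 0" "\<And>M. (\<Sum>k\<in>freq_box M - {\<lambda>_. 0}. norm (dft M H k) * maxnorm (freq k) powr \<sigma>) \<le> S"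
    using dft_weighted_sum_bounded[OF Ck per m] by blast
  obtain m' where m': "m = Suc m'" using m \<sigma> by (cases m) auto
  obtain L where L: "L > 0" "\<And>x y. \<bar>H x - H y\<bar> \<le> L * norm (x - y)"
    using Ck_lattice_periodic_lipschitz[OF Ck[unfolded m'] per] by blast
  \<comment> \<open>A Hoelder exponent of at most 1 that does not exceed the weight the coefficients
    can bear.\<close>
  define s where "s = min 1 \<sigma>"
  have s: "0 < s" "s \<le> 1" "s \<le> \<sigma>" using \<sigma> by (auto simp: s_def)
  let ?d = "real CARD('d)"
  define \<delta> where "\<delta> M = ?d * inverse (real (grid_size M))" for M
  define \<eta> where "\<eta> M = 2 * (2 * pi * ?d * \<delta> M) powr s * S + L * \<delta> M" for M
  have "filterlim (\<lambda>M. real (grid_size M)) at_top sequentially"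
    by (rule filterlim_at_top_mono[OF filterlim_real_sequentially]) (simp add: grid_size_def)
  then have "\<delta> \<longlonglongrightarrow> ?d * 0"
    unfolding \<delta>_def by (intro tendsto_mult tendsto_const tendsto_inverse_0_at_top)
  then have \<delta>: "\<delta> \<longlonglongrightarrow> 0" by simp
  have "(\<lambda>M. 2 * pi * ?d * \<delta> M) \<longlonglongrightarrow> 0"
    using tendsto_mult_left[OF \<delta>, of "2 * pi * ?d"] by simp
  then have "(\<lambda>M. (2 * pi * ?d * \<delta> M) powr s) \<longlonglongrightarrow> 0"
    using tendsto_powr'[OF _ tendsto_const[of s], of "\<lambda>M. 2 * pi * ?d * \<delta> M" 0] s
    by (auto simp: \<delta>_def)
  then have "\<eta> \<longlonglongrightarrow> 2 * 0 * S + L * 0"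
    unfolding \<eta>_def by (intro tendsto_intros \<delta>)
  then have \<eta>: "\<eta> \<longlonglongrightarrow> 0" by simp
  have "norm (trig_interp M H y - of_real (H y)) \<le> \<eta> M" for M y
  proof -
    let ?N = "real (grid_size M)"
    \<comment> \<open>\<open>z\<close> is the grid point just below \<open>y\<close> in every
      coordinate. Interpolation is exact at \<open>z\<close>, so the error at \<open>y\<close> comes
      only from the moduli of continuity over a distance of at most
      \<open>\<delta> M\<close>.\<close>
    define l where "l i = \<lfloor>?N * y $ i\<rfloor>" for i
    define z where "z = (1 / ?N) *\<^sub>R freq l"
    have "maxnorm (y - z) \<le> inverse ?N"
    proof (rule maxnorm_le)
      fix i
      have "(y - z) $ i = (?N * y $ i - of_int (l i)) / ?N"
        by (simp add: z_def field_simps)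
      moreover have "\<bar>?N * y $ i - of_int (l i)\<bar> \<le> 1" unfolding l_def by linarith
      ultimately have "\<bar>(y - z) $ i\<bar> \<le> 1 / ?N"
        by (simp only: abs_divide abs_of_nat) (simp add: divide_right_mono)
      then show "\<bar>(y - z) $ i\<bar> \<le> inverse ?N" by (simp add: inverse_eq_divide)
    qed
    then have yz: "norm (y - z) \<le> \<delta> M"
      unfolding \<delta>_def by (intro order.trans[OF norm_le_maxnorm] mult_left_mono) auto
    have "norm (trig_interp M H y - of_real (H y))
        \<le> norm (trig_interp M H y - trig_interp M H z) + norm (of_real (H z) - of_real (H y) :: complex)"
      using trig_interp_grid[OF per, of M l] norm_triangle_ineq[of "trig_interp M H y - trig_interp M H z" "of_real (H z) - of_real (H y)"]
      by (simp add: z_def)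
    also have "norm (of_real (H z) - of_real (H y) :: complex) \<le> L * norm (y - z)"
      using L(2)[of z y] by (simp add: norm_minus_commute flip: of_real_diff)
    also have "\<dots> \<le> L * \<delta> M" using L yz by (intro mult_left_mono) auto
    also have "norm (trig_interp M H y - trig_interp M H z) \<le> 2 * (2 * pi * ?d * norm (y - z)) powr s * S"
      by (rule trig_interp_holder[OF s S(2)])
    also have "\<dots> \<le> 2 * (2 * pi * ?d * \<delta> M) powr s * S"
      by (intro mult_right_mono mult_left_mono powr_mono2 yz S(1)) (use s in auto)
    finally show ?thesis unfolding \<eta>_def by simp
  qed
  then show ?thesis using that \<eta> by blast
qed

text \<open>Along the line through \<xi>0 every nonconstant character is integrated term by term, at
  the price of the divisor \<open>\<omega> k\<close>; the zero frequency stays out of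
  \<open>Q\<close> and is what produces linear growth.\<close>

lemma diophantine_primitive_bounded:
  fixes H :: "real^'d \<Rightarrow> real" and \<xi>0 :: "real^'d"
  assumes Ck: "Ck m H" and per: "lattice_periodic H" and \<sigma>: "\<sigma> > 0" and m: "real m > real CARD('d) + \<sigma>"
    and C: "C\<xi> > 0"
    and dioph: "\<And>k. k \<in> int_vec \<Longrightarrow> k \<noteq> 0 \<Longrightarrow> C\<xi> * norm k powr (- \<sigma>) \<le> \<bar>\<xi>0 \<bullet> k\<bar>"
  obtains K Q where "K \<ge> 0" "\<And>M r. norm (Q M r) \<le> K"
    "\<And>M r. (Q M has_vector_derivative trig_interp M H (r *\<^sub>R \<xi>0) - dft M H (\<lambda>_. 0)) (at r)"
proof -
  let ?d = "real CARD('d)"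
  obtain S where S: "S \<ge> 0" "\<And>M. (\<Sum>k\<in>freq_box M - {\<lambda>_. 0}. norm (dft M H k) * maxnorm (freq k) powr \<sigma>) \<le> S"
    using dft_weighted_sum_bounded[OF Ck per m] by blast
  define \<omega> where "\<omega> k = 2 * pi * (freq k \<bullet> \<xi>0)" for k
  define Q where "Q M r = (\<Sum>k\<in>freq_box M - {\<lambda>_. 0}. dft M H k / (\<i> * of_real (\<omega> k)) * cis (\<omega> k * r))" for M r
  \<comment> \<open>The power of the dimension converts the Euclidean norm of the Diophantine
    condition into \<open>maxnorm\<close>; the factor 2 pi in \<open>\<omega>\<close> is given
    away.\<close>
  define c where "c = ?d powr \<sigma> / C\<xi>"
  have \<omega>: "\<omega> k \<noteq> 0" "1 / \<bar>\<omega> k\<bar> \<le> c * maxnorm (freq k) powr \<sigma>" if "k \<noteq> (\<lambda>_. 0)" for k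
  proof -
    have K: "maxnorm (freq k) \<ge> 1" using maxnorm_freq_ge_1[OF that] .
    have nz: "freq k \<noteq> 0" using that by (auto simp: vec_eq_iff fun_eq_iff)
    have "C\<xi> * (?d * maxnorm (freq k)) powr (- \<sigma>) \<le> C\<xi> * norm (freq k) powr (- \<sigma>)"
      by (intro mult_left_mono powr_mono2' norm_le_maxnorm) (use nz C \<sigma> in auto)
    also have "\<dots> \<le> \<bar>freq k \<bullet> \<xi>0\<bar>" using dioph[OF freq_int_vec nz] by (simp add: inner_commute)
    also have "\<dots> \<le> 2 * pi * \<bar>freq k \<bullet> \<xi>0\<bar>" 
      using mult_right_mono[of 1 "2 * pi" "\<bar>freq k \<bullet> \<xi>0\<bar>"] pi_gt3 by simp
    also have "\<dots> = \<bar>\<omega> k\<bar>" by (simp add: \<omega>_def abs_mult)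
    finally have low: "C\<xi> * (?d * maxnorm (freq k)) powr (- \<sigma>) \<le> \<bar>\<omega> k\<bar>" .
    have pos: "C\<xi> * (?d * maxnorm (freq k)) powr (- \<sigma>) > 0" using C K by simp
    show "\<omega> k \<noteq> 0" using low pos by auto
    have "1 / \<bar>\<omega> k\<bar> \<le> 1 / (C\<xi> * (?d * maxnorm (freq k)) powr (- \<sigma>))"
      by (rule divide_left_mono) (use low pos in auto)
    also have "\<dots> = c * maxnorm (freq k) powr \<sigma>"
      using K by (simp add: c_def powr_minus powr_mult field_simps)
    finally show "1 / \<bar>\<omega> k\<bar> \<le> c * maxnorm (freq k) powr \<sigma>" .
  qed
  have bound: "norm (Q M r) \<le> c * S" for M r
  proof -
    have "norm (Q M r) \<le> (\<Sum>k\<in>freq_box M - {\<lambda>_. 0}. c * (norm (dft M H k) * maxnorm (freq k) powr \<sigma>))"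
      unfolding Q_def
    proof (rule sum_norm_le)
      fix k :: "'d \<Rightarrow> int" assume k: "k \<in> freq_box M - {\<lambda>_. 0}"
      have "norm (dft M H k / (\<i> * of_real (\<omega> k)) * cis (\<omega> k * r)) = norm (dft M H k) * (1 / \<bar>\<omega> k\<bar>)"
        by (simp add: norm_mult norm_divide)
      also have "\<dots> \<le> norm (dft M H k) * (c * maxnorm (freq k) powr \<sigma>)"
        by (intro mult_left_mono \<omega>) (use k in auto)
      finally show "norm (dft M H k / (\<i> * of_real (\<omega> k)) * cis (\<omega> k * r))
          \<le> c * (norm (dft M H k) * maxnorm (freq k) powr \<sigma>)" by (simp add: mult_ac)
    qed
    also have "\<dots> \<le> c * S"
      unfolding sum_distrib_left[symmetric] using C by (intro mult_left_mono S) (auto simp: c_def)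
    finally show ?thesis .
  qed
  have deriv: "(Q M has_vector_derivative trig_interp M H (r *\<^sub>R \<xi>0) - dft M H (\<lambda>_. 0)) (at r)" for M r
  proof -
    have "(Q M has_vector_derivative (\<Sum>k\<in>freq_box M - {\<lambda>_. 0}. dft M H k * cis (\<omega> k * r))) (at r)"
      unfolding Q_def
    proof (rule has_vector_derivative_sum)
      fix k :: "'d \<Rightarrow> int" assume k: "k \<in> freq_box M - {\<lambda>_. 0}"
      have "((\<lambda>r. cis (\<omega> k * r)) has_vector_derivative \<omega> k *\<^sub>R (\<i> * cis (\<omega> k * r))) (at r)"
        using exp_scaleR_has_vector_derivative_right[of "\<i> * of_real (\<omega> k)" r UNIV]
        by (simp add: cis_conv_exp scaleR_conv_of_real mult_ac)
      then have "((\<lambda>r. dft M H k / (\<i> * of_real (\<omega> k)) * cis (\<omega> k * r)) has_vector_derivative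
          dft M H k / (\<i> * of_real (\<omega> k)) * (\<omega> k *\<^sub>R (\<i> * cis (\<omega> k * r)))) (at r)"
        by (rule has_vector_derivative_mult_right)
      then show "((\<lambda>r. dft M H k / (\<i> * of_real (\<omega> k)) * cis (\<omega> k * r)) has_vector_derivative
          dft M H k * cis (\<omega> k * r)) (at r)"
        using \<omega>(1)[of k] k by (simp add: scaleR_conv_of_real mult_ac)
    qed
    moreover have "(\<Sum>k\<in>freq_box M - {\<lambda>_. 0}. dft M H k * cis (\<omega> k * r))
        = trig_interp M H (r *\<^sub>R \<xi>0) - dft M H (\<lambda>_. 0)"
    proof -
      have "freq (\<lambda>_. 0) = (0 :: real^'d)" by (simp add: vec_eq_iff)
      then show ?thesis
        by (simp add: trig_interp_def \<omega>_def sum_diff1 freq_zero_mem_freq_box mult_ac)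
    qed
    ultimately show ?thesis by simp
  qed
  show ?thesis by (rule that[of "c * S" Q]) (use S C bound deriv in \<open>auto simp: c_def\<close>)
qed

text \<open>For each grid the travel time is approximated by a linear function of position plus
  \<open>Q\<close>. The error of this approximation grows like \<open>\<eta> M * A * t\<close>,
  while the contribution of \<open>Q\<close> stays below \<open>2 * K\<close>; refining the grid at
  fixed \<open>t\<close> removes the growing term.\<close>

lemma quasiperiodic_drift:
  fixes F :: "real^'d \<Rightarrow> real" and \<xi>0 :: "real^'d"
  assumes Ck: "Ck m F" and per: "lattice_periodic F" and \<sigma>: "\<sigma> > 0" and m: "real m > real CARD('d) + \<sigma>"
    and C: "C\<xi> > 0"
    and dioph: "\<And>k. k \<in> int_vec \<Longrightarrow> k \<noteq> 0 \<Longrightarrow> C\<xi> * norm k powr (- \<sigma>) \<le> \<bar>\<xi>0 \<bullet> k\<bar>"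
    and pos: "\<And>x. F x > 0"
  obtains K \<xi> where "K > 0" "\<And>v t. (\<And>t. t \<ge> 0 \<Longrightarrow>
      (v has_real_derivative F (v t *\<^sub>R \<xi>0)) (at t within {0..})) \<Longrightarrow> t \<ge> 0 \<Longrightarrow>
      \<bar>v t - v 0 - t * \<xi>\<bar> \<le> K"
proof -
  define H where "H x = inverse (F x)" for x
  have "F x \<noteq> 0" for x using pos[of x] by simp
  then have H: "Ck m H" "lattice_periodic H"
    using Ck_inverse[OF Ck] per by (auto simp: H_def[abs_def] lattice_periodic_def)
  obtain \<eta> where \<eta>: "\<eta> \<longlonglongrightarrow> 0" "\<And>M y. norm (trig_interp M H y - of_real (H y)) \<le> \<eta> M"
    using trig_interp_uniform[OF H \<sigma> m] by blast
  obtain K Q where K: "K \<ge> 0" "\<And>M r. norm (Q M r) \<le> K"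
    and Q: "\<And>M r. (Q M has_vector_derivative trig_interp M H (r *\<^sub>R \<xi>0) - dft M H (\<lambda>_. 0)) (at r)"
    using diophantine_primitive_bounded[OF H \<sigma> m C dioph] by metis
  obtain A where A: "A > 0" "\<And>x. \<bar>F x\<bar> \<le> A"
    using lattice_periodic_bounded[OF per Ck_continuous_on[OF Ck]] by blast
  obtain B where B: "\<And>x. \<bar>H x\<bar> \<le> B"
    using lattice_periodic_bounded[OF H(2) Ck_continuous_on[OF H(1)]] by blast
  \<comment> \<open>A limit \<open>h\<close> along a subsequence of the zeroth coefficients stands
    in for the mean of \<open>H\<close> over the torus.\<close>
  have "bounded (range (\<lambda>M. dft M H (\<lambda>_. 0)))"
    unfolding bounded_iff using norm_dft_le[of H B, OF B] by auto
  then obtain h \<rho> where \<rho>: "strict_mono \<rho>" "(\<lambda>M. dft (\<rho> M) H (\<lambda>_. 0)) \<longlonglongrightarrow> h"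
    using bounded_imp_convergent_subsequence[of "\<lambda>M. dft M H (\<lambda>_. 0)"] by (auto simp: o_def)
  have main: "norm (of_real t - h * of_real (v t - v 0)) \<le> 2 * K"
    if v: "\<And>t. t \<ge> 0 \<Longrightarrow> (v has_real_derivative F (v t *\<^sub>R \<xi>0)) (at t within {0..})" and t: "t \<ge> 0" for v t
  proof -
    have approx: "norm (of_real t - dft M H (\<lambda>_. 0) * of_real (v t - v 0)) \<le> 2 * K + \<eta> M * A * t" for M
    proof -
      let ?h = "dft M H (\<lambda>_. 0)"
      \<comment> \<open>\<open>W\<close> compares the clock with the approximate travel time. Its
        derivative is F times the interpolation error, so it would be constant if the interpolant
        were exactly 1/F.\<close>
      define W where "W s = of_real s - (of_real (v s) * ?h + Q M (v s))" for s
      have W: "(W has_vector_derivative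
          of_real (F (v s *\<^sub>R \<xi>0)) * (of_real (H (v s *\<^sub>R \<xi>0)) - trig_interp M H (v s *\<^sub>R \<xi>0))) (at s within {0..})"
        if "s \<ge> 0" for s
      proof -
        have v': "(v has_vector_derivative F (v s *\<^sub>R \<xi>0)) (at s within {0..})"
          using v[OF that] by (simp add: has_real_derivative_iff_has_vector_derivative)
        have "((Q M \<circ> v) has_vector_derivative
            F (v s *\<^sub>R \<xi>0) *\<^sub>R (trig_interp M H (v s *\<^sub>R \<xi>0) - ?h)) (at s within {0..})"
          by (rule vector_diff_chain_within[OF v' has_vector_derivative_at_within[OF Q]])
        moreover have "((\<lambda>s. of_real (v s) * ?h) has_vector_derivative of_real (F (v s *\<^sub>R \<xi>0)) * ?h) (at s within {0..})"
          by (intro has_vector_derivative_mult_left has_vector_derivative_of_real v[OF that])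
        moreover have "(of_real has_vector_derivative (1 :: complex)) (at s within {0..})"
          using has_vector_derivative_of_real[OF DERIV_ident] by simp
        ultimately have "(W has_vector_derivative
            1 - (of_real (F (v s *\<^sub>R \<xi>0)) * ?h + F (v s *\<^sub>R \<xi>0) *\<^sub>R (trig_interp M H (v s *\<^sub>R \<xi>0) - ?h))) (at s within {0..})"
          unfolding W_def o_def by (intro has_vector_derivative_diff has_vector_derivative_add)
        moreover have "of_real (F (v s *\<^sub>R \<xi>0)) * of_real (H (v s *\<^sub>R \<xi>0)) = (1 :: complex)"
          using pos[of "v s *\<^sub>R \<xi>0"] by (simp add: H_def flip: of_real_mult)
        ultimately show ?thesis by (simp add: scaleR_conv_of_real algebra_simps)
      qed
      have "norm (W t - W 0) \<le> (A * \<eta> M) * norm (t - 0)"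
      proof (rule differentiable_bound[where S="{0..}" and f'="\<lambda>s x. x *\<^sub>R
            (of_real (F (v s *\<^sub>R \<xi>0)) * (of_real (H (v s *\<^sub>R \<xi>0)) - trig_interp M H (v s *\<^sub>R \<xi>0)))"])
        fix s :: real assume "s \<in> {0..}"
        then show "(W has_derivative (\<lambda>x. x *\<^sub>R
            (of_real (F (v s *\<^sub>R \<xi>0)) * (of_real (H (v s *\<^sub>R \<xi>0)) - trig_interp M H (v s *\<^sub>R \<xi>0))))) (at s within {0..})"
          using W[of s] by (simp add: has_vector_derivative_def)
        have "norm (of_real (F (v s *\<^sub>R \<xi>0)) * (of_real (H (v s *\<^sub>R \<xi>0)) - trig_interp M H (v s *\<^sub>R \<xi>0))) \<le> A * \<eta> M"
          unfolding norm_mult using A \<eta>(2)[of M "v s *\<^sub>R \<xi>0"] by (intro mult_mono) (auto simp: norm_minus_commute)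
        then show "onorm (\<lambda>x. x *\<^sub>R
            (of_real (F (v s *\<^sub>R \<xi>0)) * (of_real (H (v s *\<^sub>R \<xi>0)) - trig_interp M H (v s *\<^sub>R \<xi>0)))) \<le> A * \<eta> M"
          by (intro onorm_le) (simp add: mult.commute mult_left_mono)
      qed (use t in auto)
      moreover have "of_real t - ?h * of_real (v t - v 0) = (W t - W 0) + (Q M (v t) - Q M (v 0))"
        by (simp add: W_def algebra_simps)
      moreover have "norm (Q M (v t) - Q M (v 0)) \<le> K + K"
        by (rule norm_triangle_le_diff) (intro add_mono K)
      ultimately show ?thesis
        using norm_triangle_ineq[of "W t - W 0" "Q M (v t) - Q M (v 0)"] t by (simp add: mult_ac)
    qed
    have "(\<lambda>M. 2 * K + \<eta> (\<rho> M) * A * t) \<longlonglongrightarrow> 2 * K + 0 * A * t"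
      using LIMSEQ_subseq_LIMSEQ[OF \<eta>(1) \<rho>(1)] unfolding o_def by (intro tendsto_intros)
    moreover have "(\<lambda>M. norm (of_real t - dft (\<rho> M) H (\<lambda>_. 0) * of_real (v t - v 0)))
        \<longlonglongrightarrow> norm (of_real t - h * of_real (v t - v 0))"
      by (intro tendsto_intros \<rho>)
    ultimately show ?thesis
      using LIMSEQ_le approx by (metis (no_types, lifting) add.right_neutral mult_zero_left)
  qed
  show ?thesis
  proof (cases "h = 0")
    case True
    \<comment> \<open>For \<open>h = 0\<close> the estimate reads t \<le> 2 K for all t \<ge> 0,
      which no solution can satisfy; the values 1 and 0 chosen below are therefore
      arbitrary.\<close>
    then have no_solution: False
      if "\<And>t. t \<ge> 0 \<Longrightarrow> (v has_real_derivative F (v t *\<^sub>R \<xi>0)) (at t within {0..})" for v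
    proof -
      have "norm (of_real (2 * K + 1) :: complex) \<le> 2 * K"
        using main[OF that, of "2 * K + 1"] K True by simp
      then show False unfolding norm_of_real by linarith
    qed
    show ?thesis by (rule that[of 1 0]) (use no_solution in auto)
  next
    case False
    show ?thesis
    \<comment> \<open>\<open>h\<close> is only known as a complex number, so the real part of its
      reciprocal is taken as the drift; the summand 1 keeps the constant positive even when
      \<open>K = 0\<close>.\<close>
    proof (rule that[of "2 * K / norm h + 1" "Re (1 / h)"])
      show "2 * K / norm h + 1 > 0" using K by (simp add: add_nonneg_pos)
      fix v t
      assume v: "\<And>t. t \<ge> 0 \<Longrightarrow> (v has_real_derivative F (v t *\<^sub>R \<xi>0)) (at t within {0..})" and t: "(t::real) \<ge> 0"
      have "(h * of_real (v t - v 0) - of_real t) / h = of_real (v t - v 0) - t *\<^sub>R (1 / h)"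
        using False by (simp add: diff_divide_distrib scaleR_conv_of_real)
      then have "v t - v 0 - t * Re (1 / h) = Re ((h * of_real (v t - v 0) - of_real t) / h)"
        by simp
      also have "\<bar>\<dots>\<bar> \<le> norm ((h * of_real (v t - v 0) - of_real t) / h)" by (rule abs_Re_le_cmod)
      also have "\<dots> \<le> 2 * K / norm h"
        unfolding norm_divide using main[OF v t] by (intro divide_right_mono) (auto simp: norm_minus_commute)
      finally show "\<bar>v t - v 0 - t * Re (1 / h)\<bar> \<le> 2 * K / norm h + 1" by simp
    qed
  qed
qed

lemma homogenization_error_quasiperiodic:
  fixes F :: "real^'d \<Rightarrow> real" and \<xi>0 :: "real^'d"
  assumes Ck: "Ck m F" and per: "lattice_periodic F" and \<sigma>: "\<sigma> > 0" and m: "real m > real CARD('d) + \<sigma>"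
    and C: "C\<xi> > 0"
    and dioph: "\<And>k. k \<in> int_vec \<Longrightarrow> k \<noteq> 0 \<Longrightarrow> C\<xi> * norm k powr (- \<sigma>) \<le> \<bar>\<xi>0 \<bullet> k\<bar>"
    and pos: "\<And>x. F x > 0"
  obtains K \<xi> where "K > 0" "\<And>\<phi> \<epsilon> t x. lipschitz_wrt abs \<phi> \<Longrightarrow> \<epsilon> > 0 \<Longrightarrow> t > 0 \<Longrightarrow>
    \<bar>transport_sol \<phi> (\<lambda>u t. F ((u/\<epsilon>) *\<^sub>R \<xi>0)) x t - \<phi> (x - \<xi> * t)\<bar> \<le> lip_const abs \<phi> * K * \<epsilon>"
proof -
  obtain m' where m': "m = Suc m'" using m \<sigma> by (cases m) auto
  obtain L where L: "L > 0" "\<And>x y. \<bar>F x - F y\<bar> \<le> L * norm (x - y)"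
    using Ck_lattice_periodic_lipschitz[OF Ck[unfolded m'] per] by blast
  obtain A where A: "A > 0" "\<And>x. \<bar>F x\<bar> \<le> A"
    using lattice_periodic_bounded[OF per Ck_continuous_on[OF Ck]] by blast
  let ?G = "\<lambda>(u::real) (t::real). F (u *\<^sub>R \<xi>0)"
  \<comment> \<open>The summand 1 keeps the Lipschitz constant positive even for
    \<open>\<xi>0 = 0\<close>.\<close>
  interpret bounded_lipschitz_field ?G "L * norm \<xi>0 + 1" A
  proof
    show "continuous_on UNIV (\<lambda>(u, t). ?G u t)"
      unfolding case_prod_beta
      by (rule continuous_on_compose2[OF Ck_continuous_on[OF Ck]]) (auto intro!: continuous_intros)
    show "norm (?G x t - ?G y t) \<le> (L * norm \<xi>0 + 1) * norm (x - y)" for x y t :: real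
    proof -
      have "\<bar>?G x t - ?G y t\<bar> \<le> L * norm (x *\<^sub>R \<xi>0 - y *\<^sub>R \<xi>0)" by (rule L)
      also have "\<dots> = L * norm \<xi>0 * \<bar>x - y\<bar>" by (simp flip: scaleR_diff_left)
      also have "\<dots> \<le> (L * norm \<xi>0 + 1) * \<bar>x - y\<bar>" by (intro mult_right_mono) auto
      finally show ?thesis by simp
    qed
  qed (use A L in \<open>auto intro: add_nonneg_pos\<close>)
  obtain K \<xi> where K: "K > 0" and drift: "\<And>v t. (\<And>t. t \<ge> 0 \<Longrightarrow>
      (v has_real_derivative F (v t *\<^sub>R \<xi>0)) (at t within {0..})) \<Longrightarrow> t \<ge> 0 \<Longrightarrow>
      \<bar>v t - v 0 - t * \<xi>\<bar> \<le> K"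
    using quasiperiodic_drift[OF assms] by metis
  show ?thesis
  proof (rule that[OF K])
    fix \<phi> :: "real \<Rightarrow> real" and \<epsilon> t x :: real
    assume *: "lipschitz_wrt abs \<phi>" "\<epsilon> > 0" "t > 0"
    have "\<bar>ode_flow ?G \<tau> c - c - \<tau> * \<xi>\<bar> \<le> K" if "\<tau> > 0" for \<tau> c
      using drift[of "\<lambda>t. ode_flow ?G t c" \<tau>] ode_flow_deriv[of _ c] that
      by (simp add: has_real_derivative_iff_has_vector_derivative)
    then show "\<bar>transport_sol \<phi> (\<lambda>u t. F ((u/\<epsilon>) *\<^sub>R \<xi>0)) x t - \<phi> (x - \<xi> * t)\<bar> \<le> lip_const abs \<phi> * K * \<epsilon>"
      using transport_sol_rescaled_error[of abs \<xi> K \<phi> \<epsilon> t x] * by (simp add: abs_mult mult.commute)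
  qed
qed

theorem theorem1p7:
  shows
  \<comment> \<open>(1) n > 1\<close>
  "(\<forall>(f :: real^'n \<Rightarrow> real \<Rightarrow> real^'n) \<kappa> C0.
      CARD('n) > 1 \<longrightarrow>
      continuous_on UNIV (\<lambda>(r,\<tau>). f r \<tau>) \<longrightarrow>
      (\<forall>r r' \<tau> \<tau>'. maxnorm (f r \<tau> - f r' \<tau>') \<le> \<kappa> * max (maxnorm (r - r')) \<bar>\<tau> - \<tau>'\<bar>) \<longrightarrow>
      (\<forall>r \<tau> i. f (r + axis i 1) \<tau> = f r \<tau>) \<longrightarrow>
      (\<forall>r \<tau>. f r (\<tau> + 1) = f r \<tau>) \<longrightarrow>
      C0 > 0 \<longrightarrow>
      (\<forall>c1 c2 i \<tau>. \<tau> > 0 \<longrightarrow> (\<forall>j. 0 \<le> (c1 - c2) $ j \<and> (c1 - c2) $ j \<le> 1) \<longrightarrow>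
          (ode_flow f \<tau> c2) $ i - (ode_flow f \<tau> c1) $ i \<le> C0) \<longrightarrow>
      (\<forall>(\<phi> :: real^'n \<Rightarrow> real) \<epsilon>. lipschitz_wrt maxnorm \<phi> \<longrightarrow> \<epsilon> > 0 \<longrightarrow>
         (\<exists>\<xi>. \<forall>t>0. \<forall>x.
            \<bar>transport_sol \<phi> (\<lambda>u t. f ((1/\<epsilon>) *\<^sub>R u) (t/\<epsilon>)) x t - \<phi> (x - t *\<^sub>R \<xi>)\<bar>
              \<le> lip_const maxnorm \<phi> *
                 (1 + C0 + 2 * Max (range (\<lambda>i. SUP p\<in>UNIV. \<bar>f (fst p) (snd p) $ i\<bar>))) * \<epsilon>)))
   \<and>
  \<comment> \<open>(2-1) n = 1\<close>
   (\<forall>(f :: real \<Rightarrow> real \<Rightarrow> real) \<kappa>.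
      continuous_on UNIV (\<lambda>(r,\<tau>). f r \<tau>) \<longrightarrow>
      (\<forall>r r' \<tau> \<tau>'. \<bar>f r \<tau> - f r' \<tau>'\<bar> \<le> \<kappa> * max \<bar>r - r'\<bar> \<bar>\<tau> - \<tau>'\<bar>) \<longrightarrow>
      (\<forall>r \<tau>. f (r + 1) \<tau> = f r \<tau>) \<longrightarrow>
      (\<forall>r \<tau>. f r (\<tau> + 1) = f r \<tau>) \<longrightarrow>
      (\<forall>(\<phi> :: real \<Rightarrow> real) \<epsilon>. lipschitz_wrt abs \<phi> \<longrightarrow> \<epsilon> > 0 \<longrightarrow>
         (\<exists>\<xi>.
            (\<forall>t>0. \<forall>x.
              \<bar>transport_sol \<phi> (\<lambda>u t. f (u/\<epsilon>) (t/\<epsilon>)) x t - \<phi> (x - \<xi> * t)\<bar>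
                \<le> lip_const abs \<phi> * (1 + 2 * (SUP p\<in>UNIV. \<bar>f (fst p) (snd p)\<bar>)) * \<epsilon>) \<and>
            ((\<forall>r \<tau> \<tau>'. f r \<tau> = f r \<tau>') \<longrightarrow>
              (\<forall>t>0. \<forall>x.
                \<bar>transport_sol \<phi> (\<lambda>u t. f (u/\<epsilon>) (t/\<epsilon>)) x t - \<phi> (x - \<xi> * t)\<bar>
                  \<le> lip_const abs \<phi> * \<epsilon>)))))
   \<and>
  \<comment> \<open>(2-2) n = 1, quasi-periodic f(r) = F(\<xi>0 r)\<close>
   (\<forall>(\<xi>0 :: real^'d) (F :: real^'d \<Rightarrow> real) \<sigma> C\<xi> (m :: nat).
      \<sigma> > 0 \<longrightarrow> C\<xi> > 0 \<longrightarrow>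
      (\<forall>k\<in>int_vec. k \<noteq> 0 \<longrightarrow> \<bar>\<xi>0 \<bullet> k\<bar> \<ge> C\<xi> * norm k powr (- \<sigma>)) \<longrightarrow>
      (\<forall>x k. k \<in> int_vec \<longrightarrow> F (x + k) = F x) \<longrightarrow>
      Ck m F \<longrightarrow>
      real m > real CARD('d) + \<sigma> \<longrightarrow>
      (\<forall>x. F x > 0) \<longrightarrow>
      (\<exists>C>0. \<forall>(\<phi> :: real \<Rightarrow> real) \<epsilon>. lipschitz_wrt abs \<phi> \<longrightarrow> \<epsilon> > 0 \<longrightarrow>
         (\<exists>\<xi>. \<forall>t>0. \<forall>x.
            \<bar>transport_sol \<phi> (\<lambda>u t. F ((u/\<epsilon>) *\<^sub>R \<xi>0)) x t - \<phi> (x - \<xi> * t)\<bar>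
              \<le> lip_const abs \<phi> * C * \<epsilon>)))"
proof (intro conjI allI impI)
  fix f :: "real^'n \<Rightarrow> real \<Rightarrow> real^'n" and \<kappa> C0 :: real and \<phi> :: "real^'n \<Rightarrow> real" and \<epsilon> :: real
  assume f: "continuous_on UNIV (\<lambda>(r,\<tau>). f r \<tau>)"
    "\<forall>r r' \<tau> \<tau>'. maxnorm (f r \<tau> - f r' \<tau>') \<le> \<kappa> * max (maxnorm (r - r')) \<bar>\<tau> - \<tau>'\<bar>"
    "\<forall>r \<tau> i. f (r + axis i 1) \<tau> = f r \<tau>" "\<forall>r \<tau>. f r (\<tau> + 1) = f r \<tau>" "C0 > 0"
    "\<forall>c1 c2 i \<tau>. \<tau> > 0 \<longrightarrow> (\<forall>j. 0 \<le> (c1 - c2) $ j \<and> (c1 - c2) $ j \<le> 1) \<longrightarrow>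
      (ode_flow f \<tau> c2) $ i - (ode_flow f \<tau> c1) $ i \<le> C0"
    and \<phi>: "lipschitz_wrt maxnorm \<phi>" "\<epsilon> > 0"
  show "\<exists>\<xi>. \<forall>t>0. \<forall>x.
      \<bar>transport_sol \<phi> (\<lambda>u t. f ((1/\<epsilon>) *\<^sub>R u) (t/\<epsilon>)) x t - \<phi> (x - t *\<^sub>R \<xi>)\<bar>
        \<le> lip_const maxnorm \<phi> *
          (1 + C0 + 2 * Max (range (\<lambda>i. SUP p\<in>UNIV. \<bar>f (fst p) (snd p) $ i\<bar>))) * \<epsilon>"
  proof (rule homogenization_error_torus[OF f(1) _ _ _ f(5)])
    show "maxnorm (f r \<tau> - f r' \<tau>') \<le> \<kappa> * max (maxnorm (r - r')) \<bar>\<tau> - \<tau>'\<bar>" for r r' \<tau> \<tau>'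
      using f(2) by blast
    show "f (r + axis i 1) \<tau> = f r \<tau>" "f r (\<tau> + 1) = f r \<tau>" for r \<tau> i
      using f(3,4) by blast+
    show "ode_flow f \<tau> c2 $ i - ode_flow f \<tau> c1 $ i \<le> C0"
      if "\<tau> > 0" "\<And>j. 0 \<le> (c1 - c2) $ j \<and> (c1 - c2) $ j \<le> 1" for c1 c2 i \<tau>
      using f(6) that by blast
  qed (use \<phi> in blast)
next
  fix f :: "real \<Rightarrow> real \<Rightarrow> real" and \<kappa> :: real and \<phi> :: "real \<Rightarrow> real" and \<epsilon> :: real
  assume f: "continuous_on UNIV (\<lambda>(r,\<tau>). f r \<tau>)"
    "\<forall>r r' \<tau> \<tau>'. \<bar>f r \<tau> - f r' \<tau>'\<bar> \<le> \<kappa> * max \<bar>r - r'\<bar> \<bar>\<tau> - \<tau>'\<bar>"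
    "\<forall>r \<tau>. f (r + 1) \<tau> = f r \<tau>" "\<forall>r \<tau>. f r (\<tau> + 1) = f r \<tau>"
    and \<phi>: "lipschitz_wrt abs \<phi>" "\<epsilon> > 0"
  obtain \<xi> where \<xi>: "\<And>\<phi> \<epsilon> t x. lipschitz_wrt abs \<phi> \<Longrightarrow> \<epsilon> > 0 \<Longrightarrow> t > 0 \<Longrightarrow>
      \<bar>transport_sol \<phi> (\<lambda>u t. f (u/\<epsilon>) (t/\<epsilon>)) x t - \<phi> (x - \<xi> * t)\<bar>
        \<le> lip_const abs \<phi> * (1 + 2 * (SUP p\<in>UNIV. \<bar>f (fst p) (snd p)\<bar>)) * \<epsilon>"
    "\<And>\<phi> \<epsilon> t x. \<forall>r \<tau> \<tau>'. f r \<tau> = f r \<tau>' \<Longrightarrow>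
      lipschitz_wrt abs \<phi> \<Longrightarrow> \<epsilon> > 0 \<Longrightarrow> t > 0 \<Longrightarrow>
      \<bar>transport_sol \<phi> (\<lambda>u t. f (u/\<epsilon>) (t/\<epsilon>)) x t - \<phi> (x - \<xi> * t)\<bar>
        \<le> lip_const abs \<phi> * \<epsilon>"
  proof (rule homogenization_error_circle[OF f(1)])
    show "\<bar>f r \<tau> - f r' \<tau>'\<bar> \<le> \<kappa> * max \<bar>r - r'\<bar> \<bar>\<tau> - \<tau>'\<bar>"
      "f (r + 1) \<tau> = f r \<tau>" "f r (\<tau> + 1) = f r \<tau>" for r r' \<tau> \<tau>'
      using f(2-4) by blast+
  qed (rule that)
  show "\<exists>\<xi>.
      (\<forall>t>0. \<forall>x. \<bar>transport_sol \<phi> (\<lambda>u t. f (u/\<epsilon>) (t/\<epsilon>)) x t - \<phi> (x - \<xi> * t)\<bar>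
        \<le> lip_const abs \<phi> * (1 + 2 * (SUP p\<in>UNIV. \<bar>f (fst p) (snd p)\<bar>)) * \<epsilon>) \<and>
      ((\<forall>r \<tau> \<tau>'. f r \<tau> = f r \<tau>') \<longrightarrow>
        (\<forall>t>0. \<forall>x. \<bar>transport_sol \<phi> (\<lambda>u t. f (u/\<epsilon>) (t/\<epsilon>)) x t - \<phi> (x - \<xi> * t)\<bar>
          \<le> lip_const abs \<phi> * \<epsilon>))"
    by (intro exI[of _ \<xi>] conjI allI impI; rule \<xi>(1)[OF \<phi>] \<xi>(2)[OF _ \<phi>]; assumption)
next
  fix \<xi>0 :: "real^'d" and F :: "real^'d \<Rightarrow> real" and \<sigma> C\<xi> :: real and m :: nat
  assume F: "\<sigma> > 0" "C\<xi> > 0"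
    "\<forall>k\<in>int_vec. k \<noteq> 0 \<longrightarrow> \<bar>\<xi>0 \<bullet> k\<bar> \<ge> C\<xi> * norm k powr (- \<sigma>)"
    "\<forall>x k. k \<in> int_vec \<longrightarrow> F (x + k) = F x" "Ck m F" "real m > real CARD('d) + \<sigma>" "\<forall>x. F x > 0"
  have per: "lattice_periodic F" using F(4) by (simp add: lattice_periodic_def)
  obtain K \<xi> where K: "K > 0" "\<And>\<phi> \<epsilon> t x. lipschitz_wrt abs \<phi> \<Longrightarrow> \<epsilon> > 0 \<Longrightarrow> t > 0 \<Longrightarrow>
      \<bar>transport_sol \<phi> (\<lambda>u t. F ((u/\<epsilon>) *\<^sub>R \<xi>0)) x t - \<phi> (x - \<xi> * t)\<bar> \<le> lip_const abs \<phi> * K * \<epsilon>"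
  proof (rule homogenization_error_quasiperiodic[OF F(5) per F(1,6,2)])
    show "C\<xi> * norm k powr (- \<sigma>) \<le> \<bar>\<xi>0 \<bullet> k\<bar>" if "k \<in> int_vec" "k \<noteq> 0" for k
      using F(3) that by blast
    show "F x > 0" for x using F(7) by blast
  qed (rule that)
  show "\<exists>C>0. \<forall>(\<phi> :: real \<Rightarrow> real) \<epsilon>. lipschitz_wrt abs \<phi> \<longrightarrow> \<epsilon> > 0 \<longrightarrow>
      (\<exists>\<xi>. \<forall>t>0. \<forall>x.
        \<bar>transport_sol \<phi> (\<lambda>u t. F ((u/\<epsilon>) *\<^sub>R \<xi>0)) x t - \<phi> (x - \<xi> * t)\<bar> \<le> lip_const abs \<phi> * C * \<epsilon>)"
    by (intro exI[of _ K] conjI K(1) allI impI exI[of _ \<xi>]; rule K(2); assumption)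
qed

end
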